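(* Let $\alpha\in(0,1)$, $\kappa>0$, $\epsilon>0$, and let $0=t_0<t_1<\cdots<t_N=T$ be an arbitrary time mesh with steps $\tau_n=t_n-t_{n-1}$. Then the variable-step L1$_{\mathrm h}$ scheme is unconditionally energy stable in the sense that it preserves the following discrete energy dissipation law: every solution $\{\phi^n\}_{n=0}^N$ of the scheme $$\sum_{k=1}^n a_{n-k}^{(\mathrm{h},n)}(\phi^k-\phi^{k-1})=\kappa\Delta\mu^{n-\frac12},\qquad \mu^{n-\frac12}=f(\phi)^{n-\frac12}-\epsilon^2\Delta\phi^{n-\frac12},\qquad 1\le n\le N,$$ satisfies $$\partial_\tau\mathcal{E}_\alpha^{(\mathrm{h})}[\phi^n]:=\frac{\mathcal{E}_\alpha^{(\mathrm{h})}[\phi^n]-\mathcal{E}_\alpha^{(\mathrm{h})}[\phi^{n-1}]}{\tau_n}\le 0\qquad\text{for }1\le n\le N .$$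
   Context: Setting: $\Omega\subset\mathbb{R}^2$ is a rectangle with periodic boundary conditions; $(\cdot,\cdot)$ and $\|\cdot\|$ are the $L^2(\Omega)$ inner product and norm. The initial function $\phi^0\in H^1(\Omega)$ is real-valued and periodic; $\phi^n,\mu^{n-\frac12}$ are real-valued periodic $H^1(\Omega)$ functions and the equations of the scheme are understood in the usual weak sense (tested against periodic $H^1$ functions). Here $\phi^{n-\frac12}:=(\phi^n+\phi^{n-1})/2$ and $$f(\phi)^{n-\frac12}:=\tfrac13(\phi^n)^3+\tfrac12\phi^n(\phi^{n-1})^2+\tfrac16(\phi^{n-1})^3-\phi^{n-\frac12}.$$ For $v$ with $(v,1)=0$, $\|v\|_{-1}:=\sqrt{((-\Delta)^{-1}v,v)}$, with $(-\Delta)^{-1}$ the inverse of the periodic Laplacian on zero-mean functions (solutions of the scheme conserve the mean, so the differences $\phi^\ell-\phi^{\ell-1}$ have zero mean). Kernels: with $\omega_\beta(t):=t^{\beta-1}/\Gamma(\beta)$ and $t_{n-\frac12}:=(t_n+t_{n-1})/2$, the L1$_{\mathrm h}$ kernels are $a_{n-k}^{(\mathrm{h},n)}:=\frac1{\tau_k}\int_{t_{k-1}}^{\min\{t_k,t_{n-1/2}\}}\omega_{1-\alpha}(t_{n-\frac12}-s)\,\mathrm{d}s$ for $1\le k\le n$. The auxiliary kernels are $\mathsf{a}_0^{(\mathrm{h},n)}:=2a_0^{(\mathrm{h},n)}$ and $\mathsf{a}_j^{(\mathrm{h},n)}:=a_j^{(\mathrm{h},n)}$ for $1\le j\le n-1$.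 Their discrete orthogonal convolution kernels are $\vartheta_0^{(\mathrm{h},n)}:=1/\mathsf{a}_0^{(\mathrm{h},n)}$ and $\vartheta_{n-k}^{(\mathrm{h},n)}:=-\frac1{\mathsf{a}_0^{(\mathrm{h},k)}}\sum_{j=k+1}^n\vartheta_{n-j}^{(\mathrm{h},n)}\mathsf{a}_{j-k}^{(\mathrm{h},j)}$ for $1\le k\le n-1$, and the discrete complementary convolution kernels are $\mathsf{p}_{n-k}^{(\mathrm{h},n)}:=\sum_{j=k}^n\vartheta_{j-k}^{(\mathrm{h},j)}$ for $1\le k\le n$. Energies: $E[\phi^n]:=\frac{\epsilon^2}{2}\|\nabla\phi^n\|^2+(F(\phi^n),1)$ with $F(\phi):=\frac14(\phi^2-1)^2$ for $n\ge0$; $\mathcal{E}_\alpha^{(\mathrm{h})}[\phi^0]:=E[\phi^0]$ and $$\mathcal{E}_\alpha^{(\mathrm{h})}[\phi^n]:=E[\phi^n]+\frac{1}{2\kappa}\sum_{j=1}^n\mathsf{p}_{n-j}^{(\mathrm{h},n)}\Big\|\sum_{\ell=1}^j\mathsf{a}_{j-\ell}^{(\mathrm{h},j)}(\phi^\ell-\phi^{\ell-1})\Big\|_{-1}^2\quad\text{for }n\ge1 .$$ *)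

theory Defs
  imports "HOL-Analysis.Analysis"
begin

section \<open>Periodic Sobolev functions on a rectangle\<close>

text \<open>
  The domain is the open box with corners \<open>a\<close> and \<open>b\<close>. Elements of \<open>L\<^sup>2\<close> and \<open>H\<^sup>1\<close> are represented
  by functions on the whole space of which only the restriction to the box matters, up to null sets.
\<close>

definition L2_on :: "'a::euclidean_space set \<Rightarrow> ('a \<Rightarrow> 'b::euclidean_space) \<Rightarrow> bool" where
  "L2_on S u \<longleftrightarrow>
     u \<in> borel_measurable (lebesgue_on S) \<and> integrable (lebesgue_on S) (\<lambda>x. (norm (u x))\<^sup>2)"

definition L2_inner ::
  "'a::euclidean_space set \<Rightarrow> ('a \<Rightarrow> 'b::euclidean_space) \<Rightarrow> ('a \<Rightarrow> 'b) \<Rightarrow> real" where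
  "L2_inner S u v = (\<integral>x. u x \<bullet> v x \<partial>(lebesgue_on S))"

definition L2_norm :: "'a::euclidean_space set \<Rightarrow> ('a \<Rightarrow> 'b::euclidean_space) \<Rightarrow> real" where
  "L2_norm S u = sqrt (L2_inner S u u)"

primrec C_diff :: "nat \<Rightarrow> ('a::euclidean_space \<Rightarrow> real) \<Rightarrow> bool" where
  "C_diff 0 f \<longleftrightarrow> continuous_on UNIV f"
| "C_diff (Suc k) f \<longleftrightarrow>
     (\<forall>x. f differentiable (at x)) \<and>
     (\<forall>i\<in>Basis. C_diff k (\<lambda>x. frechet_derivative f (at x) i))"

definition smooth_periodic :: "'a::euclidean_space \<Rightarrow> 'a \<Rightarrow> ('a \<Rightarrow> real) \<Rightarrow> bool" where
  "smooth_periodic a b f \<longleftrightarrow>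
     (\<forall>k. C_diff k f) \<and> (\<forall>i\<in>Basis. \<forall>x. f (x + ((b - a) \<bullet> i) *\<^sub>R i) = f x)"

definition classical_grad :: "('a::euclidean_space \<Rightarrow> real) \<Rightarrow> 'a \<Rightarrow> 'a" where
  "classical_grad f x = (\<Sum>i\<in>Basis. frechet_derivative f (at x) i *\<^sub>R i)"

text \<open>
  The space of periodic \<open>H\<^sup>1\<close> functions is the closure of the smooth periodic functions (restricted to
  the box) in the \<open>H\<^sup>1\<close> norm. The limit of the classical gradients is the weak gradient; it is
  determined by \<open>u\<close> up to a null set, so that the choice in \<open>grad\<close> below does not affect any integral.
\<close>

definition has_grad_per ::
  "'a::euclidean_space \<Rightarrow> 'a \<Rightarrow> ('a \<Rightarrow> real) \<Rightarrow> ('a \<Rightarrow> 'a) \<Rightarrow> bool" where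
  "has_grad_per a b u G \<longleftrightarrow>
     L2_on (box a b) u \<and> L2_on (box a b) G \<and>
     (\<exists>\<psi> :: nat \<Rightarrow> 'a \<Rightarrow> real.
        (\<forall>k. smooth_periodic a b (\<psi> k)) \<and>
        (\<lambda>k. L2_norm (box a b) (\<lambda>x. \<psi> k x - u x)) \<longlonglongrightarrow> 0 \<and>
        (\<lambda>k. L2_norm (box a b) (\<lambda>x. classical_grad (\<psi> k) x - G x)) \<longlonglongrightarrow> 0)"

definition H1_per :: "'a::euclidean_space \<Rightarrow> 'a \<Rightarrow> ('a \<Rightarrow> real) set" where
  "H1_per a b = {u. \<exists>G. has_grad_per a b u G}"

definition grad :: "'a::euclidean_space \<Rightarrow> 'a \<Rightarrow> ('a \<Rightarrow> real) \<Rightarrow> 'a \<Rightarrow> 'a" where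
  "grad a b u = (SOME G. has_grad_per a b u G)"

text \<open>
  \<open>inv_neg_laplacian a b v\<close> is the zero-mean weak solution \<open>w\<close> of \<open>-\<Delta>w = v\<close> with periodic boundary
  conditions (unique up to a null set); it is only meaningful for \<open>v\<close> of zero mean.
\<close>

definition inv_neg_laplacian ::
  "'a::euclidean_space \<Rightarrow> 'a \<Rightarrow> ('a \<Rightarrow> real) \<Rightarrow> 'a \<Rightarrow> real" where
  "inv_neg_laplacian a b v =
     (SOME w. w \<in> H1_per a b \<and> L2_inner (box a b) w (\<lambda>_. 1) = 0 \<and>
        (\<forall>\<eta>\<in>H1_per a b.
           L2_inner (box a b) (grad a b w) (grad a b \<eta>) = L2_inner (box a b) v \<eta>))"

definition Hm1_norm :: "'a::euclidean_space \<Rightarrow> 'a \<Rightarrow> ('a \<Rightarrow> real) \<Rightarrow> real" where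
  "Hm1_norm a b v = sqrt (L2_inner (box a b) (inv_neg_laplacian a b v) v)"


section \<open>Convolution kernels\<close>

text \<open>
  All kernels are indexed by the two time levels \<open>n\<close> and \<open>k\<close>, with \<open>1 \<le> k \<le> n\<close>: for instance
  \<open>L1h_kernel \<alpha> t n k\<close> is the kernel written with superscript \<open>n\<close> and subscript \<open>n - k\<close>.
  In particular \<open>k = n\<close> is the subscript 0.
\<close>

definition omega :: "real \<Rightarrow> real \<Rightarrow> real" where
  "omega \<beta> s = s powr (\<beta> - 1) / Gamma \<beta>"

definition t_half :: "(nat \<Rightarrow> real) \<Rightarrow> nat \<Rightarrow> real" where
  "t_half t n = (t n + t (n - 1)) / 2"

definition L1h_kernel :: "real \<Rightarrow> (nat \<Rightarrow> real) \<Rightarrow> nat \<Rightarrow> nat \<Rightarrow> real" where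
  "L1h_kernel \<alpha> t n k =
     1 / (t k - t (k - 1)) *
       integral {t (k - 1)..min (t k) (t_half t n)} (\<lambda>s. omega (1 - \<alpha>) (t_half t n - s))"

definition aux_kernel :: "real \<Rightarrow> (nat \<Rightarrow> real) \<Rightarrow> nat \<Rightarrow> nat \<Rightarrow> real" where
  "aux_kernel \<alpha> t n k = (if k = n then 2 * L1h_kernel \<alpha> t n n else L1h_kernel \<alpha> t n k)"

text \<open>
  Discrete orthogonal convolution (DOC) kernels and discrete complementary convolution (DCC) kernels.
  Values of \<open>doc_kernel\<close> with \<open>k > n\<close> are irrelevant.
\<close>

function doc_kernel :: "real \<Rightarrow> (nat \<Rightarrow> real) \<Rightarrow> nat \<Rightarrow> nat \<Rightarrow> real" where
  "doc_kernel \<alpha> t n k =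
     (if n \<le> k then 1 / aux_kernel \<alpha> t n n
      else - (1 / aux_kernel \<alpha> t k k) *
             (\<Sum>j = k+1..n. doc_kernel \<alpha> t n j * aux_kernel \<alpha> t j k))"
  by pat_completeness auto
termination
  by (relation "Wellfounded.measure (\<lambda>(\<alpha>, t, n, k). n - k)") auto

declare doc_kernel.simps [simp del]

definition dcc_kernel :: "real \<Rightarrow> (nat \<Rightarrow> real) \<Rightarrow> nat \<Rightarrow> nat \<Rightarrow> real" where
  "dcc_kernel \<alpha> t n k = (\<Sum>j = k..n. doc_kernel \<alpha> t j k)"


section \<open>The scheme and its energies\<close>

text \<open>In \<open>f_half u v\<close> the new time level is \<open>u\<close> and the old one is \<open>v\<close>.\<close>

definition f_half :: "real \<Rightarrow> real \<Rightarrow> real" where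
  "f_half u v = 1/3 * u^3 + 1/2 * u * v^2 + 1/6 * v^3 - (u + v) / 2"

definition double_well :: "real \<Rightarrow> real" where
  "double_well u = 1/4 * (u^2 - 1)^2"

text \<open>
  Solutions \<open>\<phi> 0, \<dots>, \<phi> N\<close> of the L1h scheme in weak form; \<open>\<mu> n\<close> stands for the chemical
  potential at the half level \<open>n - 1/2\<close>.
\<close>

definition L1h_solution ::
  "'a::euclidean_space \<Rightarrow> 'a \<Rightarrow> real \<Rightarrow> real \<Rightarrow> real \<Rightarrow> (nat \<Rightarrow> real) \<Rightarrow> nat \<Rightarrow>
   (nat \<Rightarrow> 'a \<Rightarrow> real) \<Rightarrow> (nat \<Rightarrow> 'a \<Rightarrow> real) \<Rightarrow> bool" where
  "L1h_solution a b \<alpha> \<kappa> \<epsilon> t N \<phi> \<mu> \<longleftrightarrow>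
     (\<forall>n\<in>{0..N}. \<phi> n \<in> H1_per a b) \<and>
     (\<forall>n\<in>{1..N}. \<mu> n \<in> H1_per a b \<and>
       (\<forall>\<eta>\<in>H1_per a b.
          L2_inner (box a b) (\<lambda>x. \<Sum>k = 1..n. L1h_kernel \<alpha> t n k * (\<phi> k x - \<phi> (k - 1) x)) \<eta>
            = - \<kappa> * L2_inner (box a b) (grad a b (\<mu> n)) (grad a b \<eta>)) \<and>
       (\<forall>\<eta>\<in>H1_per a b.
          L2_inner (box a b) (\<mu> n) \<eta>
            = L2_inner (box a b) (\<lambda>x. f_half (\<phi> n x) (\<phi> (n - 1) x)) \<eta>
              + \<epsilon>^2 * L2_inner (box a b)
                  (grad a b (\<lambda>x. (\<phi> n x + \<phi> (n - 1) x) / 2)) (grad a b \<eta>)))"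

definition free_energy ::
  "'a::euclidean_space \<Rightarrow> 'a \<Rightarrow> real \<Rightarrow> ('a \<Rightarrow> real) \<Rightarrow> real" where
  "free_energy a b \<epsilon> u =
     \<epsilon>^2 / 2 * (L2_norm (box a b) (grad a b u))^2
     + L2_inner (box a b) (\<lambda>x. double_well (u x)) (\<lambda>_. 1)"

text \<open>For \<open>n = 0\<close> the outer sum is empty and only the free energy remains.\<close>

definition modified_energy ::
  "'a::euclidean_space \<Rightarrow> 'a \<Rightarrow> real \<Rightarrow> real \<Rightarrow> real \<Rightarrow> (nat \<Rightarrow> real) \<Rightarrow>
   (nat \<Rightarrow> 'a \<Rightarrow> real) \<Rightarrow> nat \<Rightarrow> real" where
  "modified_energy a b \<alpha> \<kappa> \<epsilon> t \<phi> n =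
     free_energy a b \<epsilon> (\<phi> n)
     + 1 / (2 * \<kappa>) *
       (\<Sum>j = 1..n. dcc_kernel \<alpha> t n j *
          (Hm1_norm a b (\<lambda>x. \<Sum>l = 1..j. aux_kernel \<alpha> t j l * (\<phi> l x - \<phi> (l - 1) x)))^2)"

end

theory Submission
  imports Defs
begin

text \<open>
  Write \<open>v\<^sub>k = \<phi> k - \<phi> (k - 1)\<close> and let \<open>w\<^sub>j = \<Sum>l\<le>j. aux_kernel j l v\<^sub>l\<close> be the auxiliary convolution.
  Since \<open>aux_kernel\<close> doubles the diagonal of \<open>L1h_kernel\<close>, the left-hand side of the scheme is
  \<open>w\<^sub>n - aux_kernel n n v\<^sub>n / 2\<close>. Testing the first equation with \<open>(-\<Delta>)\<^sup>-\<^sup>1 v\<^sub>n\<close> and the second one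
  with \<open>v\<^sub>n\<close> and eliminating \<open>\<mu>\<close> gives

    \<open>\<langle>w\<^sub>n, v\<^sub>n\<rangle> - aux_kernel n n \<parallel>v\<^sub>n\<parallel>\<^sup>2 / 2 = - \<kappa> (\<mu> n, v\<^sub>n) \<le> - \<kappa> (E[\<phi> n] - E[\<phi> (n - 1)])\<close>

  in the inner product of \<open>H\<^sup>-\<^sup>1\<close>. The inequality is the algebraic identity \<open>f_half_identity\<close>,
  whose remainder is \<open>(u - v)\<^sup>4 / 12\<close>. By \<open>dcc_kernel_diff\<close> the memory
  part of the energy changes from level \<open>n - 1\<close> to level \<open>n\<close> by
  \<open>1 / (2 \<kappa>) * (\<Sum>j\<le>n. doc_kernel n j \<parallel>w\<^sub>j\<parallel>\<^sup>2)\<close>, so that the law follows from the lower bound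
  \<open>convolution_lower_bound\<close> for the left-hand side above. That bound is a completed square together
  with the Cauchy-Schwarz inequality; it uses that the off-diagonal entries of \<open>doc_kernel\<close>, the
  inverse matrix of \<open>aux_kernel\<close>, are nonpositive and that its row sums are nonnegative. Both facts
  follow from one monotonicity property of \<open>aux_kernel\<close>: for \<open>m < n\<close> the ratio
  \<open>aux_kernel n k / aux_kernel m k\<close> is at most 1 and decreases in \<open>k\<close>. It holds on
  every mesh because \<open>\<omega>(q - s) / \<omega>(r - s)\<close> is, for \<open>r < q\<close>, at most 1 and decreasing in \<open>s\<close>;
  the diagonal, which only covers a half step, calls for a comparison of means
  (\<open>aux_kernel_ratio_upper\<close>).

  Three analytic facts make this rigorous in \<open>H1_per\<close>.

  \<^item> The weak gradient is unique almost everywhere (\<open>weak_grad_unique\<close>) and hence linear. The argument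
    tests a sequence of smooth gradients with its own members.

  \<^item> In two dimensions \<open>H1_per\<close> embeds into \<open>L\<^sup>4\<close> (\<open>H1_per_L4\<close>, an inequality of Ladyzhenskaya), so that
    the double-well energies are finite.

  \<^item> The inverse Laplacians of the \<open>v\<^sub>k\<close> exist (\<open>increment_potential_exists\<close>) because the scheme
    itself exhibits \<open>- \<kappa> \<mu> n\<close> as the potential of a triangular combination of the increments.
\<close>

section \<open>Kernels on an arbitrary mesh\<close>

lemma norm_sum_weighted_le:
  fixes w :: "'i \<Rightarrow> 'v::real_inner"
  assumes "finite J" "\<And>j. j \<in> J \<Longrightarrow> c j \<ge> 0"
  shows "(norm (\<Sum>j\<in>J. c j *\<^sub>R w j))\<^sup>2 \<le> (\<Sum>j\<in>J. c j) * (\<Sum>j\<in>J. c j * (norm (w j))\<^sup>2)"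
proof -
  have "norm (\<Sum>j\<in>J. c j *\<^sub>R w j) \<le> (\<Sum>j\<in>J. sqrt (c j) * (sqrt (c j) * norm (w j)))"
    by (rule order_trans[OF norm_sum]) (use assms in \<open>auto intro!: sum_mono simp flip: mult.assoc\<close>)
  then have "(norm (\<Sum>j\<in>J. c j *\<^sub>R w j))\<^sup>2
      \<le> (\<Sum>j\<in>J. sqrt (c j) * (sqrt (c j) * norm (w j)))\<^sup>2"
    by (intro power_mono) auto
  also have "\<dots> \<le> (\<Sum>j\<in>J. (sqrt (c j))\<^sup>2) * (\<Sum>j\<in>J. (sqrt (c j) * norm (w j))\<^sup>2)"
    by (rule Cauchy_Schwarz_ineq_sum)
  also have "\<dots> = (\<Sum>j\<in>J. c j) * (\<Sum>j\<in>J. c j * (norm (w j))\<^sup>2)"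
    using assms by (simp add: power_mult_distrib)
  finally show ?thesis .
qed

locale time_mesh =
  fixes \<alpha> :: real and t :: "nat \<Rightarrow> real" and N :: nat
  assumes alpha_pos: "0 < \<alpha>" and alpha_less_1: "\<alpha> < 1"
    and step_pos: "\<And>n. n \<in> {1..N} \<Longrightarrow> t (n - 1) < t n"
begin

lemma mesh_strict:
  assumes "i < j" "j \<le> N" shows "t i < t j"
  using assms
proof (induction j)
  case (Suc j)
  have "t j < t (Suc j)" using step_pos[of "Suc j"] Suc.prems by auto
  then show ?case using Suc by (cases "i = j") auto
qed auto

lemma mesh_mono:
  assumes "i \<le> j" "j \<le> N" shows "t i \<le> t j"
  using mesh_strict[of i j] assms by (cases "i = j") auto

lemma t_half_bounds:
  assumes "n \<in> {1..N}"
  shows "t (n - 1) < t_half t n" "t_half t n < t n"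
  using step_pos[OF assms] by (auto simp: t_half_def)

lemma t_half_mono:
  assumes "1 \<le> m" "m < n" "n \<le> N"
  shows "t_half t m < t_half t n" "t m < t_half t n"
proof -
  show "t m < t_half t n"
  proof -
    have "t m \<le> t (n - 1)" by (rule mesh_mono) (use assms in auto)
    then show ?thesis using t_half_bounds(1)[of n] assms by simp
  qed
  then show "t_half t m < t_half t n"
    using t_half_bounds[of m] assms by auto
qed

definition kernel_scale :: real where
  "kernel_scale = (1 - \<alpha>) * Gamma (1 - \<alpha>)"

lemma kernel_scale_pos: "kernel_scale > 0"
  using alpha_less_1 by (simp add: kernel_scale_def Gamma_real_pos)

lemma omega_has_integral:
  assumes "c \<le> d" "d \<le> r"
  shows "((\<lambda>s. omega (1 - \<alpha>) (r - s)) has_integral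
    ((r - c) powr (1 - \<alpha>) - (r - d) powr (1 - \<alpha>)) / kernel_scale) {c..d}"
proof -
  let ?F = "\<lambda>s. - ((r - s) powr (1 - \<alpha>)) / kernel_scale"
  have "((\<lambda>s. omega (1 - \<alpha>) (r - s)) has_integral (?F d - ?F c)) {c..d}"
  proof (rule fundamental_theorem_of_calculus_interior)
    show "c \<le> d" by fact
    show "continuous_on {c..d} ?F"
      using assms alpha_less_1 kernel_scale_pos
      by (intro continuous_intros continuous_on_powr') auto
    fix s assume s: "s \<in> {c<..<d}"
    have "(?F has_real_derivative omega (1 - \<alpha>) (r - s)) (at s)"
      using s assms alpha_less_1 kernel_scale_pos
      by (auto intro!: derivative_eq_intros simp: omega_def kernel_scale_def)
        (use Gamma_real_pos[of "1 - \<alpha>"] in \<open>auto simp: divide_simps\<close>)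
    then show "(?F has_vector_derivative omega (1 - \<alpha>) (r - s)) (at s)"
      by (simp add: has_real_derivative_iff_has_vector_derivative)
  qed
  then show ?thesis by (simp add: diff_divide_distrib)
qed

lemma omega_nonneg: "omega (1 - \<alpha>) s \<ge> 0"
  using alpha_less_1 by (simp add: omega_def Gamma_real_nonneg)

lemma aux_kernel_off_diag:
  assumes "1 \<le> k" "k < n" "n \<le> N"
  shows "aux_kernel \<alpha> t n k =
    integral {t (k - 1)..t k} (\<lambda>s. omega (1 - \<alpha>) (t_half t n - s)) / (t k - t (k - 1))"
  using t_half_mono(2)[OF assms] assms by (simp add: aux_kernel_def L1h_kernel_def)

text \<open>
  The diagonal kernel integrates only over the half step \<open>{t (n - 1)..t_half t n}\<close>. The factor 2
  turns it into a genuine mean over that half step, on a par with the off-diagonal kernels.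
\<close>

lemma aux_kernel_diag:
  assumes "n \<in> {1..N}"
  shows "aux_kernel \<alpha> t n n = ((t n - t (n - 1)) / 2) powr (- \<alpha>) / kernel_scale"
proof -
  let ?h = "(t n - t (n - 1)) / 2"
  have h: "?h > 0" using step_pos[OF assms] by simp
  have eq: "t_half t n - t (n - 1) = ?h" by (simp add: t_half_def field_simps)
  have "min (t n) (t_half t n) = t_half t n" using t_half_bounds[OF assms] by simp
  moreover have "integral {t (n - 1)..t_half t n} (\<lambda>s. omega (1 - \<alpha>) (t_half t n - s))
      = ?h powr (1 - \<alpha>) / kernel_scale"
    using integral_unique[OF omega_has_integral[of "t (n - 1)" "t_half t n" "t_half t n"]]
      t_half_bounds[OF assms] unfolding eq by simp
  ultimately have "aux_kernel \<alpha> t n n = ?h powr (1 - \<alpha>) / ?h / kernel_scale"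
    by (simp add: aux_kernel_def L1h_kernel_def)
  also have "?h powr (1 - \<alpha>) / ?h = ?h powr (- \<alpha>)"
    using h by (simp only: powr_diff powr_minus) (simp add: field_simps)
  finally show ?thesis .
qed

lemma aux_kernel_pos:
  assumes "1 \<le> k" "k \<le> n" "n \<le> N"
  shows "aux_kernel \<alpha> t n k > 0"
proof (cases "k = n")
  case True
  then show ?thesis
    using assms step_pos[of n] kernel_scale_pos by (simp add: aux_kernel_diag)
next
  case False
  have le: "t (k - 1) < t k" "t k < t_half t n"
    using assms False step_pos[of k] t_half_mono(2)[of k n] by auto
  have "(t_half t n - t k) powr (1 - \<alpha>) < (t_half t n - t (k - 1)) powr (1 - \<alpha>)"
    using le alpha_less_1 by (intro powr_less_mono2) auto
  then show ?thesis
    using le assms False kernel_scale_pos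
    by (simp add: aux_kernel_off_diag integral_unique[OF omega_has_integral])
qed

text \<open>
  This is the quotient \<open>\<omega>(t_half t n - s) / \<omega>(t_half t m - s)\<close> at the left end \<open>s = t (k - 1)\<close> of
  the \<open>k\<close>-th step. It separates the quotients of the kernels with index below \<open>k\<close> from the
  quotient with index \<open>k\<close>.
\<close>

definition memory_ratio :: "nat \<Rightarrow> nat \<Rightarrow> nat \<Rightarrow> real" where
  "memory_ratio n m k =
     ((t_half t m - t (k - 1)) / (t_half t n - t (k - 1))) powr \<alpha>"

text \<open>
  The quotient \<open>\<omega>(q - s) / \<omega>(r - s) = ((r - s) / (q - s)) powr \<alpha>\<close> decreases in \<open>s\<close>: the later
  evaluation time \<open>q\<close> forgets recent events faster than remote ones. So it can be compared with
  its value at \<open>\<sigma>\<close>.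
\<close>

lemma omega_ratio:
  assumes "r < q" "\<sigma> < r" "s < r"
  shows "s \<le> \<sigma> \<Longrightarrow> ((r - \<sigma>) / (q - \<sigma>)) powr \<alpha> * omega (1 - \<alpha>) (r - s) \<le> omega (1 - \<alpha>) (q - s)"
    and "\<sigma> \<le> s \<Longrightarrow> omega (1 - \<alpha>) (q - s) \<le> ((r - \<sigma>) / (q - \<sigma>)) powr \<alpha> * omega (1 - \<alpha>) (r - s)"
proof -
  have eq: "omega (1 - \<alpha>) (q - s)
    = ((r - s) / (q - s)) powr \<alpha> * omega (1 - \<alpha>) (r - s)"
    using assms by (simp add: omega_def powr_divide powr_minus field_simps)
  show "((r - \<sigma>) / (q - \<sigma>)) powr \<alpha> * omega (1 - \<alpha>) (r - s) \<le> omega (1 - \<alpha>) (q - s)"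
    if "s \<le> \<sigma>"
  proof -
    have "(q - r) * s \<le> (q - r) * \<sigma>" using assms that by (intro mult_left_mono) auto
    then have "(r - \<sigma>) * (q - s) \<le> (r - s) * (q - \<sigma>)" by (simp add: algebra_simps)
    then have "(r - \<sigma>) / (q - \<sigma>) \<le> (r - s) / (q - s)"
      using assms by (simp add: pos_divide_le_eq pos_le_divide_eq)
    then show ?thesis unfolding eq
      using assms alpha_pos by (intro mult_right_mono powr_mono2 omega_nonneg) auto
  qed
  show "omega (1 - \<alpha>) (q - s) \<le> ((r - \<sigma>) / (q - \<sigma>)) powr \<alpha> * omega (1 - \<alpha>) (r - s)"
    if "\<sigma> \<le> s"
  proof -
    have "(q - r) * \<sigma> \<le> (q - r) * s" using assms that by (intro mult_left_mono) auto
    then have "(r - s) * (q - \<sigma>) \<le> (r - \<sigma>) * (q - s)" by (simp add: algebra_simps)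
    then have "(r - s) / (q - s) \<le> (r - \<sigma>) / (q - \<sigma>)"
      using assms by (simp add: pos_divide_le_eq pos_le_divide_eq)
    then show ?thesis unfolding eq
      using assms alpha_pos by (intro mult_right_mono powr_mono2 omega_nonneg) auto
  qed
qed

lemma omega_integrable:
  "c \<le> d \<Longrightarrow> d \<le> r \<Longrightarrow> (\<lambda>s. omega (1 - \<alpha>) (r - s)) integrable_on {c..d}"
  using omega_has_integral by blast

lemma aux_kernel_ratio_lower:
  assumes "1 \<le> i" "i < k" "k \<le> m" "m < n" "n \<le> N"
  shows "memory_ratio n m k * aux_kernel \<alpha> t m i \<le> aux_kernel \<alpha> t n i"
proof -
  let ?\<rho> = "memory_ratio n m k"
  have le: "t (i - 1) < t i" "t i \<le> t (k - 1)" "t (k - 1) < t_half t m"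
    "t_half t m < t_half t n"
    using assms step_pos[of i] mesh_mono[of i "k - 1"] t_half_mono(1)[of m n]
      mesh_mono[of "k - 1" "m - 1"] t_half_bounds[of m]
    by fastforce+
  have "?\<rho> * integral {t (i - 1)..t i} (\<lambda>s. omega (1 - \<alpha>) (t_half t m - s))
      = integral {t (i - 1)..t i} (\<lambda>s. ?\<rho> * omega (1 - \<alpha>) (t_half t m - s))"
    by simp
  also have "\<dots> \<le> integral {t (i - 1)..t i} (\<lambda>s. omega (1 - \<alpha>) (t_half t n - s))"
    using le unfolding memory_ratio_def
    by (intro integral_le integrable_on_mult_right omega_integrable omega_ratio(1)) auto
  finally show ?thesis
    using assms le by (simp add: aux_kernel_off_diag divide_right_mono)
qed

text \<open>
  For \<open>k < m\<close> the bound holds pointwise under the integral. For \<open>k = m\<close> the two kernels are means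
  over different intervals, and the comparison is done with the antiderivative: with step \<open>h\<close> and
  distance \<open>\<delta>\<close> from \<open>t k\<close> to the half level \<open>n\<close>, the factor \<open>memory_ratio\<close> turns the mean over the half
  step into \<open>(\<delta> + h) powr (- \<alpha>)\<close>, up to normalization. This is the mean of the kernel over all of
  \<open>{0..\<delta> + h}\<close>, which exceeds the mean over \<open>{\<delta>..\<delta> + h}\<close> since the kernel decreases.
\<close>

lemma aux_kernel_ratio_upper:
  assumes "1 \<le> k" "k \<le> m" "m < n" "n \<le> N"
  shows "aux_kernel \<alpha> t n k \<le> memory_ratio n m k * aux_kernel \<alpha> t m k"
proof (cases "k = m")
  case False
  let ?\<rho> = "memory_ratio n m k"
  have le: "t (k - 1) < t k" "t k < t_half t m" "t_half t m < t_half t n"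
    using assms False step_pos[of k] t_half_mono[of k m] t_half_mono(1)[of m n] by auto
  have "integral {t (k - 1)..t k} (\<lambda>s. omega (1 - \<alpha>) (t_half t n - s))
      \<le> integral {t (k - 1)..t k} (\<lambda>s. ?\<rho> * omega (1 - \<alpha>) (t_half t m - s))"
    using le unfolding memory_ratio_def
    by (intro integral_le integrable_on_mult_right omega_integrable omega_ratio(2)) auto
  also have "\<dots> = ?\<rho> * integral {t (k - 1)..t k} (\<lambda>s. omega (1 - \<alpha>) (t_half t m - s))"
    by simp
  finally show ?thesis
    using assms le False by (simp add: aux_kernel_off_diag divide_right_mono)
next
  case True
  define h where "h = t k - t (k - 1)"
  define \<delta> where "\<delta> = t_half t n - t k"
  have h: "h > 0" "\<delta> > 0"
    using assms step_pos[of k] t_half_mono(2)[of k n] True by (auto simp: h_def \<delta>_def)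
  have eqs: "t_half t n - t (k - 1) = \<delta> + h" "t_half t k - t (k - 1) = h / 2"
    by (auto simp: h_def \<delta>_def t_half_def field_simps)
  have upper: "aux_kernel \<alpha> t n k = ((\<delta> + h) powr (1 - \<alpha>) - \<delta> powr (1 - \<alpha>)) / kernel_scale / h"
    using assms True h eqs
    by (simp add: aux_kernel_off_diag integral_unique[OF omega_has_integral] h_def \<delta>_def)
  have lower: "memory_ratio n k k * aux_kernel \<alpha> t k k
      = (h * (\<delta> + h) powr (- \<alpha>)) / kernel_scale / h"
  proof -
    have "memory_ratio n k k = (h / 2) powr \<alpha> / (\<delta> + h) powr \<alpha>"
      unfolding memory_ratio_def eqs by (rule powr_divide)
    moreover have "aux_kernel \<alpha> t k k = 1 / (h / 2) powr \<alpha> / kernel_scale"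
      using assms aux_kernel_diag[of k] unfolding h_def powr_minus_divide by simp
    moreover have "(h / 2) powr \<alpha> > 0" using h by simp
    moreover have "x / y * (1 / x / c) = h * (1 / y) / c / h" if "x > 0" for x y c :: real
      using that h(1) by simp
    ultimately show ?thesis unfolding powr_minus_divide by metis
  qed
  have "(\<delta> + h) powr (1 - \<alpha>) - \<delta> powr (1 - \<alpha>) \<le> h * (\<delta> + h) powr (- \<alpha>)"
  proof -
    have split: "x powr (1 - \<alpha>) = x * x powr (- \<alpha>)" if "x > 0" for x :: real
      using that by (simp add: powr_diff powr_minus field_simps)
    have "\<delta> * (\<delta> + h) powr (- \<alpha>) \<le> \<delta> * \<delta> powr (- \<alpha>)"
      using h alpha_pos by (intro mult_left_mono powr_mono2') auto
    then show ?thesis using h by (simp add: split algebra_simps)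
  qed
  then have "aux_kernel \<alpha> t n k \<le> memory_ratio n k k * aux_kernel \<alpha> t k k"
    unfolding upper lower using h kernel_scale_pos by (intro divide_right_mono) auto
  then show ?thesis using True by simp
qed

lemma aux_kernel_antimono:
  assumes "1 \<le> k" "k \<le> m" "m \<le> n" "n \<le> N"
  shows "aux_kernel \<alpha> t n k \<le> aux_kernel \<alpha> t m k"
proof (cases "m = n")
  case False
  then have "m < n" using assms by simp
  have "t (k - 1) < t_half t m" "t_half t m < t_half t n"
    using assms False mesh_mono[of "k - 1" "m - 1"] t_half_bounds[of m] t_half_mono(1)[of m n]
    by fastforce+
  then have "memory_ratio n m k \<le> 1"
    using alpha_pos unfolding memory_ratio_def by (intro powr_le1) auto
  then have "memory_ratio n m k * aux_kernel \<alpha> t m k \<le> 1 * aux_kernel \<alpha> t m k"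
    using aux_kernel_pos[of k m] assms by (intro mult_right_mono) auto
  then show ?thesis using aux_kernel_ratio_upper[of k m n] assms \<open>m < n\<close> by simp
qed simp

text \<open>
  Both quotients \<open>aux_kernel n i / aux_kernel m i\<close> for \<open>i = k\<close> and \<open>i = Suc k\<close> are compared with the
  same \<open>memory_ratio\<close>. Equivalently, the quotient of two adjacent columns increases with the row index.
\<close>

lemma aux_kernel_cross:
  assumes "1 \<le> k" "k < m" "m \<le> n" "n \<le> N"
  shows "aux_kernel \<alpha> t m k * aux_kernel \<alpha> t n (Suc k)
    \<le> aux_kernel \<alpha> t n k * aux_kernel \<alpha> t m (Suc k)"
proof (cases "m = n")
  case False
  let ?\<rho> = "memory_ratio n m (Suc k)"
  have "aux_kernel \<alpha> t m k * aux_kernel \<alpha> t n (Suc k)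
      \<le> aux_kernel \<alpha> t m k * (?\<rho> * aux_kernel \<alpha> t m (Suc k))"
    using assms False aux_kernel_pos[of k m]
    by (intro mult_left_mono aux_kernel_ratio_upper) auto
  also have "\<dots> = (?\<rho> * aux_kernel \<alpha> t m k) * aux_kernel \<alpha> t m (Suc k)" by simp
  also have "\<dots> \<le> aux_kernel \<alpha> t n k * aux_kernel \<alpha> t m (Suc k)"
    using assms False aux_kernel_pos[of "Suc k" m]
    by (intro mult_right_mono aux_kernel_ratio_lower) auto
  finally show ?thesis .
qed simp

lemma doc_kernel_diag: "doc_kernel \<alpha> t n n = 1 / aux_kernel \<alpha> t n n"
  by (subst doc_kernel.simps) simp

lemma doc_kernel_orthogonal:
  assumes "1 \<le> k" "k \<le> n" "n \<le> N"
  shows "(\<Sum>j = k..n. doc_kernel \<alpha> t n j * aux_kernel \<alpha> t j k) = (if k = n then 1 else 0)"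
proof (cases "k = n")
  case True
  then show ?thesis using aux_kernel_pos[of n n] assms by (simp add: doc_kernel_diag)
next
  case False
  have "doc_kernel \<alpha> t n k * aux_kernel \<alpha> t k k
      = - (\<Sum>j = k + 1..n. doc_kernel \<alpha> t n j * aux_kernel \<alpha> t j k)"
    using False assms aux_kernel_pos[of k k] by (subst doc_kernel.simps) simp
  then show ?thesis
    using False assms by (simp add: sum.atLeast_Suc_atMost)
qed

text \<open>
  Downward induction on the column. Column \<open>k + 1\<close> of the orthogonality relation vanishes, so any
  multiple of it may be subtracted from column \<open>k\<close>. The multiple \<open>q\<close> is chosen to cancel the entry
  in the last row, the only one whose coefficient in \<open>doc_kernel\<close> is positive; by \<open>aux_kernel_cross\<close>
  the other differences are nonpositive, as are their coefficients by the induction hypothesis.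
\<close>

lemma doc_kernel_nonpos:
  assumes "1 \<le> k" "k < n" "n \<le> N"
  shows "doc_kernel \<alpha> t n k \<le> 0"
  using assms
proof (induction "n - k" arbitrary: k rule: less_induct)
  case less
  have pos: "aux_kernel \<alpha> t k k > 0" using aux_kernel_pos[of k k] less.prems by simp
  have rec: "doc_kernel \<alpha> t n k * aux_kernel \<alpha> t k k
      = - (\<Sum>j = Suc k..n. doc_kernel \<alpha> t n j * aux_kernel \<alpha> t j k)"
    using doc_kernel_orthogonal[of k n] less.prems by (simp add: sum.atLeast_Suc_atMost)
  have "0 \<le> (\<Sum>j = Suc k..n. doc_kernel \<alpha> t n j * aux_kernel \<alpha> t j k)"
  proof (cases "Suc k = n")
    case True
    then show ?thesis
      using aux_kernel_pos[of n n] aux_kernel_pos[of k n] less.prems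
      by (simp add: doc_kernel_diag)
  next
    case False
    define q where "q = aux_kernel \<alpha> t n k / aux_kernel \<alpha> t n (Suc k)"
    have "(\<Sum>j = Suc k..n. doc_kernel \<alpha> t n j * aux_kernel \<alpha> t j k)
        = (\<Sum>j = Suc k..n. doc_kernel \<alpha> t n j * aux_kernel \<alpha> t j k)
          - q * (\<Sum>j = Suc k..n. doc_kernel \<alpha> t n j * aux_kernel \<alpha> t j (Suc k))"
      using doc_kernel_orthogonal[of "Suc k" n] less.prems False by simp
    also have "\<dots> = (\<Sum>j = Suc k..n. doc_kernel \<alpha> t n j *
        (aux_kernel \<alpha> t j k - q * aux_kernel \<alpha> t j (Suc k)))"
      by (simp add: sum_distrib_left sum_subtractf algebra_simps)
    also have "\<dots> \<ge> 0"
    proof (rule sum_nonneg)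
      fix j assume j: "j \<in> {Suc k..n}"
      have pos': "aux_kernel \<alpha> t n (Suc k) > 0"
        using aux_kernel_pos[of "Suc k" n] less.prems by simp
      show "0 \<le> doc_kernel \<alpha> t n j * (aux_kernel \<alpha> t j k - q * aux_kernel \<alpha> t j (Suc k))"
      proof (cases "j = n")
        case True
        then show ?thesis using pos' by (simp add: q_def)
      next
        case False
        then have "doc_kernel \<alpha> t n j \<le> 0" using j less.hyps[of j] less.prems by auto
        moreover have "aux_kernel \<alpha> t j k \<le> q * aux_kernel \<alpha> t j (Suc k)"
          using aux_kernel_cross[of k j n] j less.prems pos' by (simp add: q_def field_simps)
        ultimately show ?thesis by (simp add: mult_nonpos_nonpos)
      qed
    qed
    finally show ?thesis .
  qed
  then have "doc_kernel \<alpha> t n k * aux_kernel \<alpha> t k k \<le> 0" using rec by simp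
  then show ?case using pos by (simp add: mult_le_0_iff)
qed

text \<open>
  The first column of the orthogonality relation is a row sum weighted by the decreasing sequence
  \<open>aux_kernel j 1\<close>. Replacing all weights by the smallest one, which belongs to \<open>j = n\<close>, can only
  increase the sum, because the other coefficients are nonpositive.
\<close>

lemma doc_kernel_row_sum_nonneg:
  assumes "n \<in> {1..N}"
  shows "0 \<le> (\<Sum>j = 1..n. doc_kernel \<alpha> t n j)"
proof -
  have "0 \<le> (\<Sum>j = 1..n. doc_kernel \<alpha> t n j * aux_kernel \<alpha> t j 1)"
    using doc_kernel_orthogonal[of 1 n] assms by simp
  also have "\<dots> \<le> (\<Sum>j = 1..n. doc_kernel \<alpha> t n j * aux_kernel \<alpha> t n 1)"
  proof (rule sum_mono)
    fix j assume j: "j \<in> {1..n}"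
    show "doc_kernel \<alpha> t n j * aux_kernel \<alpha> t j 1 \<le> doc_kernel \<alpha> t n j * aux_kernel \<alpha> t n 1"
      using j assms doc_kernel_nonpos[of j n] aux_kernel_antimono[of 1 j n]
      by (cases "j = n") (auto intro: mult_left_mono_neg)
  qed
  also have "\<dots> = aux_kernel \<alpha> t n 1 * (\<Sum>j = 1..n. doc_kernel \<alpha> t n j)"
    by (simp add: sum_distrib_left mult.commute)
  finally show ?thesis
    using aux_kernel_pos[of 1 n] assms by (simp add: zero_le_mult_iff)
qed

lemma doc_kernel_inverts:
  fixes g :: "nat \<Rightarrow> 'v::real_vector"
  assumes "n \<in> {1..N}"
  shows "(\<Sum>j = 1..n. doc_kernel \<alpha> t n j *\<^sub>R (\<Sum>l = 1..j. aux_kernel \<alpha> t j l *\<^sub>R g l)) = g n"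
proof -
  have "(\<Sum>j = 1..n. doc_kernel \<alpha> t n j *\<^sub>R (\<Sum>l = 1..j. aux_kernel \<alpha> t j l *\<^sub>R g l))
      = (\<Sum>j = 1..n. \<Sum>l = 1..j. (doc_kernel \<alpha> t n j * aux_kernel \<alpha> t j l) *\<^sub>R g l)"
    by (simp add: scaleR_sum_right)
  also have "\<dots> = (\<Sum>l = 1..n. \<Sum>j = l..n. (doc_kernel \<alpha> t n j * aux_kernel \<alpha> t j l) *\<^sub>R g l)"
    by (simp add: sum.Sigma) (rule sum.reindex_bij_witness[of _ prod.swap prod.swap]; auto)
  also have "\<dots> = (\<Sum>l = 1..n. (if l = n then 1 else 0) *\<^sub>R g l)"
    using assms by (intro sum.cong) (auto simp: doc_kernel_orthogonal simp flip: scaleR_sum_left)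
  also have "\<dots> = g n" using assms by (simp add: if_distrib[of "\<lambda>x. x *\<^sub>R _"] sum.delta cong: if_cong)
  finally show ?thesis .
qed

text \<open>
  Inverting the convolution gives \<open>g n = w n / A - s\<close>, where \<open>A\<close> is the diagonal kernel and \<open>s\<close>
  collects the terms with \<open>j < n\<close>. The right-hand side is then the completed square
  \<open>(norm (w n))\<^sup>2 / (2 A) - A (norm s)\<^sup>2 / 2\<close>. The weights in \<open>s\<close> are nonnegative with sum at most
  \<open>1 / A\<close>, so \<open>A (norm s)\<^sup>2\<close> is bounded by the weighted sum of the \<open>(norm (w j))\<^sup>2\<close>.
\<close>

lemma convolution_lower_bound:
  fixes g :: "nat \<Rightarrow> 'v::real_inner"
  assumes n: "n \<in> {1..N}"
  defines "w \<equiv> \<lambda>j. \<Sum>l = 1..j. aux_kernel \<alpha> t j l *\<^sub>R g l"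
  shows "1/2 * (\<Sum>j = 1..n. doc_kernel \<alpha> t n j * (norm (w j))\<^sup>2)
    \<le> w n \<bullet> g n - 1/2 * aux_kernel \<alpha> t n n * (norm (g n))\<^sup>2"
proof -
  let ?\<theta> = "doc_kernel \<alpha> t n"
  define A where "A = aux_kernel \<alpha> t n n"
  define J where "J = {1..<n}"
  define Q where "Q = (\<Sum>j\<in>J. - ?\<theta> j * (norm (w j))\<^sup>2)"
  define s where "s = (\<Sum>j\<in>J. - ?\<theta> j *\<^sub>R w j)"
  have A: "A > 0" using aux_kernel_pos[of n n] n by (simp add: A_def)
  have \<theta>n: "?\<theta> n = 1 / A" by (simp add: doc_kernel_diag A_def)
  have last: "sum f {1..n} = f n + sum f J" for f :: "nat \<Rightarrow> 'u::comm_monoid_add"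
    using n by (simp add: J_def sum.last_plus)
  have inv: "(\<Sum>j = 1..n. ?\<theta> j *\<^sub>R w j) = g n"
    unfolding w_def by (rule doc_kernel_inverts[OF n])
  have g: "g n = (1 / A) *\<^sub>R w n - s"
    using inv unfolding last by (simp add: \<theta>n s_def sum_negf)
  have nonneg: "- ?\<theta> j \<ge> 0" if "j \<in> J" for j
    using doc_kernel_nonpos[of j n] that n by (auto simp: J_def)
  have "(norm s)\<^sup>2 \<le> (\<Sum>j\<in>J. - ?\<theta> j) * Q"
    unfolding s_def Q_def by (rule norm_sum_weighted_le) (use nonneg in \<open>auto simp: J_def\<close>)
  also have "\<dots> \<le> 1 / A * Q"
  proof (rule mult_right_mono)
    show "(\<Sum>j\<in>J. - ?\<theta> j) \<le> 1 / A"
      using doc_kernel_row_sum_nonneg[OF n] unfolding last by (simp add: \<theta>n sum_negf)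
    show "Q \<ge> 0" unfolding Q_def using nonneg by (intro sum_nonneg mult_nonneg_nonneg) auto
  qed
  finally have key: "A * (norm s)\<^sup>2 \<le> Q" using A by (simp add: field_simps)
  have "w n \<bullet> g n - 1/2 * A * (norm (g n))\<^sup>2
      = 1/2 * (1 / A) * (norm (w n))\<^sup>2 - 1/2 * (A * (norm s)\<^sup>2)"
    using A by (simp add: g power2_norm_eq_inner inner_diff inner_commute algebra_simps)
  moreover have "(\<Sum>j = 1..n. ?\<theta> j * (norm (w j))\<^sup>2) = 1 / A * (norm (w n))\<^sup>2 - Q"
    unfolding last by (simp add: \<theta>n Q_def sum_negf)
  ultimately show ?thesis using key unfolding A_def[symmetric] by simp
qed

text \<open>
  The complementary kernels are sums of the orthogonal kernels over the first index, so that
  the memory energy telescopes and only row \<open>n\<close> of \<open>doc_kernel\<close> remains.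
\<close>

lemma dcc_kernel_diff:
  fixes q :: "nat \<Rightarrow> real"
  assumes "1 \<le> n"
  shows "(\<Sum>j = 1..n. dcc_kernel \<alpha> t n j * q j) - (\<Sum>j = 1..n - 1. dcc_kernel \<alpha> t (n - 1) j * q j)
    = (\<Sum>j = 1..n. doc_kernel \<alpha> t n j * q j)"
proof -
  obtain m where m: "n = Suc m" using assms by (cases n) auto
  have "dcc_kernel \<alpha> t (Suc m) j = dcc_kernel \<alpha> t m j + doc_kernel \<alpha> t (Suc m) j"
    if "j \<le> m" for j
    using that by (simp add: dcc_kernel_def)
  then have "(\<Sum>j = 1..m. dcc_kernel \<alpha> t (Suc m) j * q j)
      = (\<Sum>j = 1..m. dcc_kernel \<alpha> t m j * q j) + (\<Sum>j = 1..m. doc_kernel \<alpha> t (Suc m) j * q j)"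
    by (simp add: algebra_simps flip: sum.distrib)
  then show ?thesis by (simp add: m dcc_kernel_def)
qed

end

section \<open>The space of square integrable functions\<close>

context
  fixes S :: "'a::euclidean_space set"
begin

lemma L2_integrable_inner:
  fixes u v :: "'a \<Rightarrow> 'b::euclidean_space"
  assumes "L2_on S u" "L2_on S v"
  shows "integrable (lebesgue_on S) (\<lambda>x. u x \<bullet> v x)"
proof (rule Bochner_Integration.integrable_bound)
  show "integrable (lebesgue_on S) (\<lambda>x. (norm (u x))\<^sup>2 + (norm (v x))\<^sup>2)"
    using assms by (auto simp: L2_on_def)
  show "(\<lambda>x. u x \<bullet> v x) \<in> borel_measurable (lebesgue_on S)"
    using assms unfolding L2_on_def by (intro borel_measurable_inner) auto
  have "\<bar>u x \<bullet> v x\<bar> \<le> (norm (u x))\<^sup>2 + (norm (v x))\<^sup>2" for x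
  proof -
    have "\<bar>u x \<bullet> v x\<bar> \<le> norm (u x) * norm (v x)" by (rule Cauchy_Schwarz_ineq2)
    moreover have "2 * (norm (u x) * norm (v x)) \<le> (norm (u x))\<^sup>2 + (norm (v x))\<^sup>2"
      using sum_squares_bound[of "norm (u x)" "norm (v x)"] by (simp add: mult.assoc)
    ultimately show ?thesis using mult_nonneg_nonneg[of "norm (u x)" "norm (v x)"] by simp
  qed
  then show "AE x in lebesgue_on S. norm (u x \<bullet> v x)
      \<le> norm ((norm (u x))\<^sup>2 + (norm (v x))\<^sup>2)" by simp
qed

lemma L2_on_scaleR: "L2_on S u \<Longrightarrow> L2_on S (\<lambda>x. c *\<^sub>R u x)"
  for u :: "'a \<Rightarrow> 'b::euclidean_space"
  unfolding L2_on_def by (auto simp: power_mult_distrib)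

lemma L2_on_add:
  fixes u v :: "'a \<Rightarrow> 'b::euclidean_space"
  assumes "L2_on S u" "L2_on S v" shows "L2_on S (\<lambda>x. u x + v x)"
  unfolding L2_on_def
proof
  show "(\<lambda>x. u x + v x) \<in> borel_measurable (lebesgue_on S)"
    using assms by (auto simp: L2_on_def)
  have "(norm (u x + v x))\<^sup>2 = (norm (u x))\<^sup>2 + 2 * (u x \<bullet> v x) + (norm (v x))\<^sup>2" for x
    by (simp add: power2_norm_eq_inner inner_add inner_commute)
  then show "integrable (lebesgue_on S) (\<lambda>x. (norm (u x + v x))\<^sup>2)"
    using assms L2_integrable_inner[OF assms] by (auto simp: L2_on_def)
qed

lemma L2_on_diff: "L2_on S u \<Longrightarrow> L2_on S v \<Longrightarrow> L2_on S (\<lambda>x. u x - v x)"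
  for u v :: "'a \<Rightarrow> 'b::euclidean_space"
  using L2_on_add[of u "\<lambda>x. (-1) *\<^sub>R v x"] L2_on_scaleR[of v "-1"] by simp

lemma L2_on_zero: "L2_on S (\<lambda>_. 0)" by (simp add: L2_on_def)

lemma L2_on_sum:
  fixes u :: "'i \<Rightarrow> 'a \<Rightarrow> 'b::euclidean_space"
  assumes "\<And>i. i \<in> I \<Longrightarrow> L2_on S (u i)" shows "L2_on S (\<lambda>x. \<Sum>i\<in>I. u i x)"
  using assms by (induction I rule: infinite_finite_induct) (auto intro: L2_on_zero L2_on_add)

lemma L2_inner_commute: "L2_inner S u v = L2_inner S v u"
  by (simp add: L2_inner_def inner_commute)

lemma L2_inner_add_left:
  "L2_on S u \<Longrightarrow> L2_on S v \<Longrightarrow> L2_on S w \<Longrightarrow>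
    L2_inner S (\<lambda>x. u x + v x) w = L2_inner S u w + L2_inner S v w"
  unfolding L2_inner_def by (simp add: inner_add_left L2_integrable_inner)

lemma L2_inner_diff_left:
  "L2_on S u \<Longrightarrow> L2_on S v \<Longrightarrow> L2_on S w \<Longrightarrow>
    L2_inner S (\<lambda>x. u x - v x) w = L2_inner S u w - L2_inner S v w"
  unfolding L2_inner_def by (simp add: inner_diff_left L2_integrable_inner)

lemma L2_inner_scaleR_left: "L2_inner S (\<lambda>x. c *\<^sub>R u x) w = c * L2_inner S u w"
  unfolding L2_inner_def by simp

lemma L2_inner_add_right:
  "L2_on S u \<Longrightarrow> L2_on S v \<Longrightarrow> L2_on S w \<Longrightarrow>
    L2_inner S w (\<lambda>x. u x + v x) = L2_inner S w u + L2_inner S w v"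
  unfolding L2_inner_def by (simp add: inner_add_right L2_integrable_inner)

lemma L2_inner_diff_right:
  "L2_on S u \<Longrightarrow> L2_on S v \<Longrightarrow> L2_on S w \<Longrightarrow>
    L2_inner S w (\<lambda>x. u x - v x) = L2_inner S w u - L2_inner S w v"
  unfolding L2_inner_def by (simp add: inner_diff_right L2_integrable_inner)

lemma L2_inner_scaleR_right: "L2_inner S w (\<lambda>x. c *\<^sub>R u x) = c * L2_inner S w u"
  unfolding L2_inner_def by simp

lemma L2_inner_self_nonneg: "L2_inner S u u \<ge> 0"
  unfolding L2_inner_def by simp

lemma L2_norm_nonneg: "L2_norm S u \<ge> 0"
  by (simp add: L2_norm_def L2_inner_self_nonneg)

lemma L2_norm_power2: "(L2_norm S u)\<^sup>2 = L2_inner S u u"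
  by (simp add: L2_norm_def L2_inner_self_nonneg)

lemma L2_norm_minus_commute: "L2_norm S (\<lambda>x. u x - v x) = L2_norm S (\<lambda>x. v x - u x)"
  by (simp add: L2_norm_def L2_inner_def power2_norm_eq_inner[symmetric] norm_minus_commute)

lemma L2_norm_scaleR: "L2_norm S (\<lambda>x. c *\<^sub>R u x) = \<bar>c\<bar> * L2_norm S u"
  by (simp add: L2_norm_def L2_inner_def real_sqrt_mult)

lemma L2_Cauchy_Schwarz:
  assumes "L2_on S u" "L2_on S v"
  shows "\<bar>L2_inner S u v\<bar> \<le> L2_norm S u * L2_norm S v"
proof -
  \<comment> \<open>The discriminant of this nonnegative quadratic in \<open>c\<close> cannot be positive.\<close>
  have quad: "0 \<le> L2_inner S u u * c\<^sup>2 + 2 * L2_inner S u v * c + L2_inner S v v" for c :: real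
  proof -
    have "0 \<le> L2_inner S (\<lambda>x. c *\<^sub>R u x + v x) (\<lambda>x. c *\<^sub>R u x + v x)"
      by (rule L2_inner_self_nonneg)
    also have "\<dots> = c * (c * L2_inner S u u + L2_inner S u v)
        + (c * L2_inner S v u + L2_inner S v v)"
      using assms
      by (simp add: L2_inner_add_left L2_inner_add_right L2_inner_scaleR_left
          L2_inner_scaleR_right L2_on_add L2_on_scaleR algebra_simps)
    finally show ?thesis by (simp add: L2_inner_commute[of v u] power2_eq_square algebra_simps)
  qed
  have "(L2_inner S u v)\<^sup>2 \<le> L2_inner S u u * L2_inner S v v"
  proof (cases "L2_inner S u u = 0")
    case True
    have "L2_inner S u v = 0"
    proof (rule ccontr)
      assume "L2_inner S u v \<noteq> 0"
      then show False
        using quad[of "- (L2_inner S v v + 1) / (2 * L2_inner S u v)"] True by (simp add: field_simps)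
    qed
    then show ?thesis using True by simp
  next
    case False
    then have "L2_inner S u u > 0" using L2_inner_self_nonneg[of u] by simp
    then show ?thesis
      using quad[of "- L2_inner S u v / L2_inner S u u"]
      by (simp add: power2_eq_square field_simps)
  qed
  then show ?thesis
    unfolding L2_norm_def real_sqrt_mult[symmetric] by (intro real_le_rsqrt) simp
qed

lemma L2_norm_triangle:
  assumes "L2_on S u" "L2_on S v"
  shows "L2_norm S (\<lambda>x. u x + v x) \<le> L2_norm S u + L2_norm S v"
proof (rule power2_le_imp_le)
  have "(L2_norm S (\<lambda>x. u x + v x))\<^sup>2 = L2_inner S u (\<lambda>x. u x + v x) + L2_inner S v (\<lambda>x. u x + v x)"
    using assms by (simp add: L2_norm_power2 L2_inner_add_left L2_on_add)
  also have "\<dots> = L2_inner S u u + 2 * L2_inner S u v + L2_inner S v v"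
    using assms by (simp add: L2_inner_add_right L2_inner_commute[of v u])
  also have "\<dots> \<le> (L2_norm S u + L2_norm S v)\<^sup>2"
    using L2_Cauchy_Schwarz[OF assms] by (simp add: power2_sum L2_norm_power2)
  finally show "(L2_norm S (\<lambda>x. u x + v x))\<^sup>2 \<le> (L2_norm S u + L2_norm S v)\<^sup>2" .
  show "0 \<le> L2_norm S u + L2_norm S v" by (simp add: L2_norm_nonneg)
qed

lemma L2_converges_add:
  assumes "\<And>k. L2_on S (u k)" "\<And>k. L2_on S (v k)" "L2_on S u'" "L2_on S v'"
    and "(\<lambda>k. L2_norm S (\<lambda>x. u k x - u' x)) \<longlonglongrightarrow> 0" "(\<lambda>k. L2_norm S (\<lambda>x. v k x - v' x)) \<longlonglongrightarrow> 0"
  shows "(\<lambda>k. L2_norm S (\<lambda>x. (u k x + v k x) - (u' x + v' x))) \<longlonglongrightarrow> 0"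
proof (rule Lim_null_comparison)
  show "\<forall>\<^sub>F k in sequentially. norm (L2_norm S (\<lambda>x. (u k x + v k x) - (u' x + v' x)))
      \<le> L2_norm S (\<lambda>x. u k x - u' x) + L2_norm S (\<lambda>x. v k x - v' x)"
    using L2_norm_triangle[of "\<lambda>x. u _ x - u' x" "\<lambda>x. v _ x - v' x"] assms(1-4)
    by (auto simp: L2_norm_nonneg L2_on_diff algebra_simps)
  show "(\<lambda>k. L2_norm S (\<lambda>x. u k x - u' x) + L2_norm S (\<lambda>x. v k x - v' x)) \<longlonglongrightarrow> 0"
    using tendsto_add[OF assms(5,6)] by simp
qed

lemma L2_converges_scaleR:
  assumes "(\<lambda>k. L2_norm S (\<lambda>x. u k x - u' x)) \<longlonglongrightarrow> 0"
  shows "(\<lambda>k. L2_norm S (\<lambda>x. c *\<^sub>R u k x - c *\<^sub>R u' x)) \<longlonglongrightarrow> 0"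
  using tendsto_mult_right_zero[OF assms, of "\<bar>c\<bar>"]
  by (simp add: L2_norm_scaleR flip: scaleR_diff_right)

lemma L2_inner_tendsto:
  assumes "\<And>k. L2_on S (u k)" "L2_on S u'" "L2_on S w"
    and "(\<lambda>k. L2_norm S (\<lambda>x. u k x - u' x)) \<longlonglongrightarrow> 0"
  shows "(\<lambda>k. L2_inner S (u k) w) \<longlonglongrightarrow> L2_inner S u' w"
proof (rule LIM_zero_cancel, rule Lim_null_comparison)
  show "\<forall>\<^sub>F k in sequentially. norm (L2_inner S (u k) w - L2_inner S u' w)
      \<le> L2_norm S (\<lambda>x. u k x - u' x) * L2_norm S w"
    using L2_Cauchy_Schwarz[of "\<lambda>x. u _ x - u' x" w] assms(1-3)
    by (auto simp: L2_on_diff L2_inner_diff_left)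
  show "(\<lambda>k. L2_norm S (\<lambda>x. u k x - u' x) * L2_norm S w) \<longlonglongrightarrow> 0"
    by (rule tendsto_mult_left_zero[OF assms(4)])
qed

lemma L2_norm_tendsto:
  assumes "\<And>k. L2_on S (u k)" "L2_on S u'"
    and "(\<lambda>k. L2_norm S (\<lambda>x. u k x - u' x)) \<longlonglongrightarrow> 0"
  shows "(\<lambda>k. L2_norm S (u k)) \<longlonglongrightarrow> L2_norm S u'"
proof (rule LIM_zero_cancel, rule Lim_null_comparison)
  have "\<bar>L2_norm S (u k) - L2_norm S u'\<bar> \<le> L2_norm S (\<lambda>x. u k x - u' x)" for k
    using L2_norm_triangle[of "\<lambda>x. u k x - u' x" u'] L2_norm_triangle[of "\<lambda>x. u' x - u k x" "u k"]
      L2_norm_minus_commute[of u' "u k"] assms(1,2) by (auto simp: L2_on_diff)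
  then show "\<forall>\<^sub>F k in sequentially. norm (L2_norm S (u k) - L2_norm S u')
      \<le> L2_norm S (\<lambda>x. u k x - u' x)" by simp
qed (rule assms)

lemma L2_inner_self_eq_0_AE:
  assumes "L2_on S u" "L2_inner S u u = 0"
  shows "AE x in lebesgue_on S. u x = 0"
proof -
  have "AE x in lebesgue_on S. (norm (u x))\<^sup>2 = 0"
    using assms integral_nonneg_eq_0_iff_AE[of "lebesgue_on S" "\<lambda>x. (norm (u x))\<^sup>2"]
    by (auto simp: L2_on_def L2_inner_def power2_norm_eq_inner)
  then show ?thesis by simp
qed

lemma L2_inner_cong_AE:
  assumes "AE x in lebesgue_on S. u x = u' x" "AE x in lebesgue_on S. v x = v' x"
    and "L2_on S u" "L2_on S u'" "L2_on S v" "L2_on S v'"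
  shows "L2_inner S u v = L2_inner S u' v'"
  unfolding L2_inner_def
proof (rule integral_cong_AE)
  show "AE x in lebesgue_on S. u x \<bullet> v x = u' x \<bullet> v' x" using assms(1,2) by eventually_elim simp
qed (use assms(3-) in \<open>auto dest: L2_integrable_inner\<close>)

end

text \<open>
  Continuity is required up to the boundary: it makes the function bounded.
\<close>

lemma L2_on_continuous:
  fixes f :: "'a::euclidean_space \<Rightarrow> 'b::euclidean_space"
  assumes "continuous_on (cbox a b) f" shows "L2_on (box a b) f"
proof -
  have integrable: "integrable (lebesgue_on (box a b)) g"
    if "continuous_on (cbox a b) g" for g :: "'a \<Rightarrow> 'c::euclidean_space"
  proof -
    have "set_integrable lebesgue (cbox a b) g"
      by (rule absolutely_integrable_continuous[OF that])
    then have "set_integrable lebesgue (box a b) g"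
      by (rule set_integrable_subset) (auto simp: box_subset_cbox)
    then show ?thesis by (simp add: set_integrable_def integrable_restrict_space)
  qed
  show ?thesis
    unfolding L2_on_def
    using integrable[OF assms] assms by (auto intro!: integrable continuous_intros)
qed

section \<open>Smooth periodic functions and uniqueness of the weak gradient\<close>

definition partial_deriv :: "'a::euclidean_space \<Rightarrow> ('a \<Rightarrow> real) \<Rightarrow> 'a \<Rightarrow> real" where
  "partial_deriv i f x = frechet_derivative f (at x) i"

lemma partial_deriv_eq: "(f has_derivative f') (at x) \<Longrightarrow> partial_deriv i f x = f' i"
  by (simp add: partial_deriv_def frechet_derivative_at[symmetric])

lemma C_diff_Suc_iff: "C_diff (Suc k) f \<longleftrightarrow>
    (\<forall>x. f differentiable (at x)) \<and> (\<forall>i\<in>Basis. C_diff k (partial_deriv i f))"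
  by (simp add: partial_deriv_def[abs_def])

lemma has_derivative_frechet:
  "f differentiable (at x) \<Longrightarrow> (f has_derivative frechet_derivative f (at x)) (at x)"
  by (simp add: frechet_derivative_works)

lemma partial_deriv_lincomb:
  assumes "f differentiable (at x)" "g differentiable (at x)"
  shows "partial_deriv i (\<lambda>x. c * f x + d * g x) x
    = c * partial_deriv i f x + d * partial_deriv i g x"
  using assms[THEN has_derivative_frechet]
  by (subst partial_deriv_eq) (auto intro!: derivative_eq_intros simp: partial_deriv_def)

lemma C_diff_lincomb:
  "C_diff k f \<Longrightarrow> C_diff k g \<Longrightarrow> C_diff k (\<lambda>x. c * f x + d * g x)"
proof (induction k arbitrary: f g)
  case 0
  then show ?case by (auto intro!: continuous_intros)
next
  case (Suc k)
  have "partial_deriv i (\<lambda>x. c * f x + d * g x)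
      = (\<lambda>x. c * partial_deriv i f x + d * partial_deriv i g x)" for i
    using Suc.prems unfolding C_diff_Suc_iff by (auto simp: partial_deriv_lincomb)
  then show ?case
    using Suc unfolding C_diff_Suc_iff by (auto intro!: derivative_intros)
qed

lemma C_diff_const: "C_diff k (\<lambda>_. c)"
proof (induction k arbitrary: c)
  case (Suc k)
  have "partial_deriv i (\<lambda>_. c) = (\<lambda>_. 0)" for i :: 'a
    by (auto intro!: partial_deriv_eq derivative_intros)
  then show ?case using Suc unfolding C_diff_Suc_iff by auto
qed auto

context
  fixes a b :: "'a::euclidean_space"
begin

lemma smooth_periodic_lincomb:
  "smooth_periodic a b f \<Longrightarrow> smooth_periodic a b g \<Longrightarrow> smooth_periodic a b (\<lambda>x. c * f x + d * g x)"
  by (simp add: smooth_periodic_def C_diff_lincomb)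

lemma smooth_periodic_const: "smooth_periodic a b (\<lambda>_. c)"
  by (simp add: smooth_periodic_def C_diff_const)

lemma smooth_periodic_differentiable: "smooth_periodic a b f \<Longrightarrow> f differentiable (at x)"
  using C_diff_Suc_iff[of 0 f] by (simp add: smooth_periodic_def)

lemma smooth_periodic_continuous: "smooth_periodic a b f \<Longrightarrow> continuous_on X f"
  unfolding smooth_periodic_def using C_diff.simps(1) continuous_on_subset by blast

lemma smooth_periodic_partial_deriv:
  assumes "smooth_periodic a b f" "i \<in> Basis"
  shows "smooth_periodic a b (partial_deriv i f)"
  unfolding smooth_periodic_def
proof (intro conjI allI ballI)
  fix k show "C_diff k (partial_deriv i f)"
    using assms C_diff_Suc_iff[of k f] by (auto simp: smooth_periodic_def)
next
  fix j x assume j: "j \<in> (Basis :: 'a set)"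
  define p where "p = ((b - a) \<bullet> j) *\<^sub>R j"
  have per: "f (y + p) = f y" for y using assms j by (auto simp: smooth_periodic_def p_def)
  have "(f has_derivative frechet_derivative f (at (x + p))) (at (x + p))"
    by (intro has_derivative_frechet smooth_periodic_differentiable assms)
  moreover have "((\<lambda>y. y + p) has_derivative (\<lambda>y. y)) (at x)"
    by (auto intro!: derivative_eq_intros)
  ultimately have "((\<lambda>y. f (y + p)) has_derivative frechet_derivative f (at (x + p))) (at x)"
    by (rule has_derivative_compose[rotated])
  then have "(f has_derivative frechet_derivative f (at (x + p))) (at x)" by (simp add: per)
  then show "partial_deriv i f (x + ((b - a) \<bullet> j) *\<^sub>R j) = partial_deriv i f x"
    using partial_deriv_eq[of f _ x i] by (simp add: p_def partial_deriv_def)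
qed

lemma smooth_periodic_classical_grad_lincomb:
  assumes "smooth_periodic a b f" "smooth_periodic a b g"
  shows "classical_grad (\<lambda>x. c * f x + d * g x) x = c *\<^sub>R classical_grad f x + d *\<^sub>R classical_grad g x"
proof -
  have "partial_deriv i (\<lambda>x. c * f x + d * g x) x
      = c * partial_deriv i f x + d * partial_deriv i g x" for i
    by (intro partial_deriv_lincomb assms[THEN smooth_periodic_differentiable])
  then show ?thesis
    unfolding classical_grad_def partial_deriv_def[symmetric]
    by (simp add: scaleR_sum_right scaleR_left_distrib sum.distrib)
qed

lemma classical_grad_inner:
  "classical_grad f x \<bullet> classical_grad g x
    = (\<Sum>i\<in>Basis. partial_deriv i f x * partial_deriv i g x)"
  unfolding classical_grad_def partial_deriv_def
  by (subst euclidean_inner) (simp add: inner_sum_left_Basis)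

lemma smooth_periodic_continuous_classical_grad:
  assumes "smooth_periodic a b f" shows "continuous_on X (classical_grad f)"
  unfolding classical_grad_def[abs_def] partial_deriv_def[symmetric]
  by (intro continuous_intros smooth_periodic_continuous smooth_periodic_partial_deriv assms)

text \<open>
  Only a linear relation between pairs of a function and a gradient field: linearity of the chosen
  gradient \<open>grad\<close> needs uniqueness as well.
\<close>

lemma has_grad_per_lincomb:
  assumes "has_grad_per a b u G" "has_grad_per a b v H"
  shows "has_grad_per a b (\<lambda>x. c * u x + d * v x) (\<lambda>x. c *\<^sub>R G x + d *\<^sub>R H x)"
proof -
  obtain \<psi> where \<psi>: "\<And>k. smooth_periodic a b (\<psi> k)"
    "(\<lambda>k. L2_norm (box a b) (\<lambda>x. \<psi> k x - u x)) \<longlonglongrightarrow> 0"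
    "(\<lambda>k. L2_norm (box a b) (\<lambda>x. classical_grad (\<psi> k) x - G x)) \<longlonglongrightarrow> 0"
    using assms(1) unfolding has_grad_per_def by blast
  obtain \<zeta> where \<zeta>: "\<And>k. smooth_periodic a b (\<zeta> k)"
    "(\<lambda>k. L2_norm (box a b) (\<lambda>x. \<zeta> k x - v x)) \<longlonglongrightarrow> 0"
    "(\<lambda>k. L2_norm (box a b) (\<lambda>x. classical_grad (\<zeta> k) x - H x)) \<longlonglongrightarrow> 0"
    using assms(2) unfolding has_grad_per_def by blast
  have L2: "L2_on (box a b) u" "L2_on (box a b) v" "L2_on (box a b) G" "L2_on (box a b) H"
    using assms by (auto simp: has_grad_per_def)
  note L2_smooth = L2_on_continuous[OF smooth_periodic_continuous[OF \<psi>(1)]]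
    L2_on_continuous[OF smooth_periodic_continuous_classical_grad[OF \<psi>(1)]]
    L2_on_continuous[OF smooth_periodic_continuous[OF \<zeta>(1)]]
    L2_on_continuous[OF smooth_periodic_continuous_classical_grad[OF \<zeta>(1)]]
  let ?\<xi> = "\<lambda>k x. c * \<psi> k x + d * \<zeta> k x"
  show ?thesis unfolding has_grad_per_def
  proof (intro conjI exI[of _ ?\<xi>] allI)
    show "L2_on (box a b) (\<lambda>x. c * u x + d * v x)"
      using L2 L2_on_scaleR[of "box a b" u c] L2_on_scaleR[of "box a b" v d] by (simp add: L2_on_add)
    show "L2_on (box a b) (\<lambda>x. c *\<^sub>R G x + d *\<^sub>R H x)"
      using L2 by (simp add: L2_on_add L2_on_scaleR)
    show "smooth_periodic a b (?\<xi> k)" for k by (intro smooth_periodic_lincomb \<psi> \<zeta>)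
    have "(\<lambda>k. L2_norm (box a b) (\<lambda>x. (c *\<^sub>R \<psi> k x + d *\<^sub>R \<zeta> k x) - (c *\<^sub>R u x + d *\<^sub>R v x))) \<longlonglongrightarrow> 0"
      by (intro L2_converges_add L2_converges_scaleR L2_on_scaleR L2_smooth L2 \<psi> \<zeta>)
    then show "(\<lambda>k. L2_norm (box a b) (\<lambda>x. ?\<xi> k x - (c * u x + d * v x))) \<longlonglongrightarrow> 0" by simp
    have "(\<lambda>k. L2_norm (box a b) (\<lambda>x. (c *\<^sub>R classical_grad (\<psi> k) x + d *\<^sub>R classical_grad (\<zeta> k) x)
        - (c *\<^sub>R G x + d *\<^sub>R H x))) \<longlonglongrightarrow> 0"
      by (intro L2_converges_add L2_converges_scaleR L2_on_scaleR L2_smooth L2 \<psi> \<zeta>)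
    then show "(\<lambda>k. L2_norm (box a b) (\<lambda>x. classical_grad (?\<xi> k) x
        - (c *\<^sub>R G x + d *\<^sub>R H x))) \<longlonglongrightarrow> 0"
      by (simp add: smooth_periodic_classical_grad_lincomb \<psi> \<zeta>)
  qed
qed

lemma has_grad_per_const: "has_grad_per a b (\<lambda>_. c) (\<lambda>_. 0)"
proof -
  have "classical_grad (\<lambda>_. c) x = 0" for x :: 'a
    unfolding classical_grad_def by (simp add: frechet_derivative_at[symmetric, OF has_derivative_const])
  then show ?thesis
    unfolding has_grad_per_def
    by (auto intro!: exI[of _ "\<lambda>_ _. c"] L2_on_continuous smooth_periodic_const
        simp: L2_norm_def L2_inner_def)
qed

end

lemma L2_inner_continuous:
  fixes u v :: "'a::euclidean_space \<Rightarrow> 'b::euclidean_space"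
  assumes "continuous_on (cbox a b) u" "continuous_on (cbox a b) v"
  shows "L2_inner (box a b) u v = integral (cbox a b) (\<lambda>x. u x \<bullet> v x)"
  unfolding L2_inner_def
  using lebesgue_integral_eq_integral[OF L2_integrable_inner[OF assms[THEN L2_on_continuous]]]
  by (simp add: integral_open_interval)

lemma has_real_derivative_slice:
  fixes h :: "real \<times> real \<Rightarrow> real"
  assumes "h differentiable (at (x, y))"
  shows "((\<lambda>s. h (s, y)) has_real_derivative partial_deriv (1, 0) h (x, y)) (at x within X)"
    and "((\<lambda>s. h (x, s)) has_real_derivative partial_deriv (0, 1) h (x, y)) (at y within X)"
proof -
  let ?D = "frechet_derivative h (at (x, y))"
  have D: "(h has_derivative ?D) (at (x, y))" by (rule has_derivative_frechet[OF assms])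
  then interpret D: linear ?D by (rule has_derivative_linear)
  have "((\<lambda>s. h (s, y)) has_derivative (\<lambda>s. ?D (s, 0))) (at x within X)"
    by (rule has_derivative_compose[where f = "\<lambda>s. (s, y)" and g = h, OF _ D]) (auto intro!: derivative_eq_intros)
  moreover have "(\<lambda>s. ?D (s, 0)) = (*) (partial_deriv (1, 0) h (x, y))"
  proof
    fix s show "?D (s, 0) = partial_deriv (1, 0) h (x, y) * s"
      using D.scaleR[of s "(1, 0)"] by (simp add: partial_deriv_def mult.commute)
  qed
  ultimately show "((\<lambda>s. h (s, y)) has_real_derivative partial_deriv (1, 0) h (x, y)) (at x within X)"
    by (simp add: has_field_derivative_def)
  have "((\<lambda>s. h (x, s)) has_derivative (\<lambda>s. ?D (0, s))) (at y within X)"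
    by (rule has_derivative_compose[where f = "\<lambda>s. (x, s)" and g = h, OF _ D]) (auto intro!: derivative_eq_intros)
  moreover have "(\<lambda>s. ?D (0, s)) = (*) (partial_deriv (0, 1) h (x, y))"
  proof
    fix s show "?D (0, s) = partial_deriv (0, 1) h (x, y) * s"
      using D.scaleR[of s "(0, 1)"] by (simp add: partial_deriv_def mult.commute)
  qed
  ultimately show "((\<lambda>s. h (x, s)) has_real_derivative partial_deriv (0, 1) h (x, y)) (at y within X)"
    by (simp add: has_field_derivative_def)
qed

lemma integral_iterated:
  fixes g :: "real \<times> real \<Rightarrow> real"
  assumes "continuous_on (cbox a b) g"
  shows "integral (cbox a b) g = integral {fst a..fst b} (\<lambda>x. integral {snd a..snd b} (\<lambda>y. g (x, y)))"
    and "integral (cbox a b) g = integral {snd a..snd b} (\<lambda>y. integral {fst a..fst b} (\<lambda>x. g (x, y)))"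
proof -
  have c: "continuous_on (cbox (fst a, snd a) (fst b, snd b)) (\<lambda>(x, y). g (x, y))"
    using assms by simp
  show 1: "integral (cbox a b) g = integral {fst a..fst b} (\<lambda>x. integral {snd a..snd b} (\<lambda>y. g (x, y)))"
    using integral_prod_continuous[of "fst a" "snd a" "fst b" "snd b" g] assms by simp
  show "integral (cbox a b) g = integral {snd a..snd b} (\<lambda>y. integral {fst a..fst b} (\<lambda>x. g (x, y)))"
    using integral_swap_continuous[OF c] unfolding 1 by simp
qed

lemma Basis_real_prod: "(Basis :: (real \<times> real) set) = {(1, 0), (0, 1)}"
  by (auto simp: Basis_prod_def)

text \<open>
  Integrating first along the direction \<open>i\<close>, the inner integral is the difference of the values of
  \<open>h\<close> on opposite edges.
\<close>

lemma integral_partial_deriv_periodic: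
  fixes h :: "real \<times> real \<Rightarrow> real"
  assumes le: "fst a \<le> fst b" "snd a \<le> snd b"
    and diff: "\<And>x. h differentiable (at x)"
    and cont: "continuous_on UNIV (partial_deriv i h)"
    and i: "i \<in> Basis"
    and per: "\<And>x. h (x + ((b - a) \<bullet> i) *\<^sub>R i) = h x"
  shows "integral (cbox a b) (partial_deriv i h) = 0"
proof -
  have cont': "continuous_on (cbox a b) (partial_deriv i h)"
    using cont continuous_on_subset by blast
  consider "i = (1, 0)" | "i = (0, 1)" using i by (auto simp: Basis_real_prod)
  then show ?thesis
  proof cases
    case 1
    have "integral {fst a..fst b} (\<lambda>x. partial_deriv i h (x, y)) = 0" for y
    proof -
      have "((\<lambda>x. partial_deriv i h (x, y)) has_integral h (fst b, y) - h (fst a, y)) {fst a..fst b}"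
        using le has_real_derivative_slice(1)[OF diff]
        by (intro fundamental_theorem_of_calculus)
          (auto simp: 1 simp flip: has_real_derivative_iff_has_vector_derivative)
      moreover have "h (fst b, y) = h (fst a, y)"
        using per[of "(fst a, y)"] by (simp add: 1 inner_prod_def)
      ultimately show ?thesis by (simp add: integral_unique)
    qed
    then show ?thesis unfolding integral_iterated(2)[OF cont'] by simp
  next
    case 2
    have "integral {snd a..snd b} (\<lambda>y. partial_deriv i h (x, y)) = 0" for x
    proof -
      have "((\<lambda>y. partial_deriv i h (x, y)) has_integral h (x, snd b) - h (x, snd a)) {snd a..snd b}"
        using le has_real_derivative_slice(2)[OF diff]
        by (intro fundamental_theorem_of_calculus)
          (auto simp: 2 simp flip: has_real_derivative_iff_has_vector_derivative)
      moreover have "h (x, snd b) = h (x, snd a)"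
        using per[of "(x, snd a)"] by (simp add: 2 inner_prod_def)
      ultimately show ?thesis by (simp add: integral_unique)
    qed
    then show ?thesis unfolding integral_iterated(1)[OF cont'] by simp
  qed
qed

locale rectangle =
  fixes a b :: "real \<times> real"
  assumes fst_less: "fst a < fst b" and snd_less: "snd a < snd b"
begin

text \<open>
  Both sides differ by the integral of the divergence of \<open>f \<nabla>g\<close>, which is periodic.
\<close>

lemma Green_identity:
  assumes f: "smooth_periodic a b f" and g: "smooth_periodic a b g"
  shows "L2_inner (box a b) (classical_grad f) (classical_grad g)
    = - L2_inner (box a b) f (\<lambda>x. \<Sum>i\<in>Basis. partial_deriv i (partial_deriv i g) x)"
proof -
  note cont = smooth_periodic_continuous[of a b] smooth_periodic_partial_deriv f g
  have cont_laplacian: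
    "continuous_on X (\<lambda>x. \<Sum>i\<in>Basis. partial_deriv i (partial_deriv i g) x)" for X
    by (intro continuous_intros cont)
  note cont_grad = smooth_periodic_continuous_classical_grad[OF f]
    smooth_periodic_continuous_classical_grad[OF g]
  have "integral (cbox a b) (\<lambda>x. partial_deriv i f x * partial_deriv i g x
      + f x * partial_deriv i (partial_deriv i g) x) = 0" if i: "i \<in> Basis" for i
  proof -
    have product: "partial_deriv i (\<lambda>x. f x * partial_deriv i g x) x
        = partial_deriv i f x * partial_deriv i g x + f x * partial_deriv i (partial_deriv i g) x" for x
      using has_derivative_mult[OF has_derivative_frechet has_derivative_frechet,
          OF smooth_periodic_differentiable[OF f]
            smooth_periodic_differentiable[OF smooth_periodic_partial_deriv[OF g i]]]
      by (subst partial_deriv_eq, assumption) (simp add: partial_deriv_def)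
    have "integral (cbox a b) (partial_deriv i (\<lambda>x. f x * partial_deriv i g x)) = 0"
    proof (rule integral_partial_deriv_periodic)
      show "(\<lambda>x. f x * partial_deriv i g x) differentiable at x" for x
        using smooth_periodic_differentiable[OF f]
          smooth_periodic_differentiable[OF smooth_periodic_partial_deriv[OF g i]] by simp
      show "continuous_on UNIV (partial_deriv i (\<lambda>x. f x * partial_deriv i g x))"
        unfolding product[abs_def] using i by (intro continuous_intros cont)
      show "f (x + ((b - a) \<bullet> i) *\<^sub>R i) * partial_deriv i g (x + ((b - a) \<bullet> i) *\<^sub>R i)
          = f x * partial_deriv i g x" for x
        using f smooth_periodic_partial_deriv[OF g i] i
        by (simp add: smooth_periodic_def del: split_paired_All)
    qed (use fst_less snd_less i in auto)
    then show ?thesis by (simp add: product[abs_def])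
  qed
  then have "0 = (\<Sum>i\<in>Basis. integral (cbox a b) (\<lambda>x. partial_deriv i f x * partial_deriv i g x
      + f x * partial_deriv i (partial_deriv i g) x))" by simp
  also have "\<dots> = integral (cbox a b) (\<lambda>x. \<Sum>i\<in>Basis. partial_deriv i f x * partial_deriv i g x
      + f x * partial_deriv i (partial_deriv i g) x)"
    by (intro integral_sum[symmetric] integrable_continuous continuous_intros cont) auto
  also have "\<dots> = integral (cbox a b) (\<lambda>x. classical_grad f x \<bullet> classical_grad g x
      + f x \<bullet> (\<Sum>i\<in>Basis. partial_deriv i (partial_deriv i g) x))"
    by (simp add: classical_grad_inner sum.distrib sum_distrib_left)
  also have "\<dots> = integral (cbox a b) (\<lambda>x. classical_grad f x \<bullet> classical_grad g x)
      + integral (cbox a b) (\<lambda>x. f x \<bullet> (\<Sum>i\<in>Basis. partial_deriv i (partial_deriv i g) x))"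
    by (intro integral_add integrable_continuous continuous_intros cont cont_grad)
  also have "\<dots> = L2_inner (box a b) (classical_grad f) (classical_grad g)
      + L2_inner (box a b) f (\<lambda>x. \<Sum>i\<in>Basis. partial_deriv i (partial_deriv i g) x)"
    by (simp add: L2_inner_continuous cont_grad cont_laplacian smooth_periodic_continuous[OF f])
  finally show ?thesis by simp
qed

text \<open>
  The gradient of a smooth function \<open>D j\<close> is itself an admissible test field: by the Green identity the
  inner products of \<open>classical_grad (D k)\<close> with it tend to 0 as \<open>k\<close> grows, since \<open>D k\<close> tends to 0.
  So \<open>H\<close> is orthogonal to each \<open>classical_grad (D j)\<close>, and hence to their limit \<open>H\<close>.
\<close>

lemma gradient_closable:
  assumes smooth: "\<And>k. smooth_periodic a b (D k)"
    and D: "(\<lambda>k. L2_norm (box a b) (D k)) \<longlonglongrightarrow> 0"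
    and H: "L2_on (box a b) H" "(\<lambda>k. L2_norm (box a b) (\<lambda>x. classical_grad (D k) x - H x)) \<longlonglongrightarrow> 0"
  shows "AE x in lebesgue_on (box a b). H x = 0"
proof -
  note L2_smooth = L2_on_continuous[OF smooth_periodic_continuous[of a b]]
    L2_on_continuous[OF smooth_periodic_continuous_classical_grad[of a b]]
  have ortho: "L2_inner (box a b) (classical_grad (D j)) H = 0" for j
  proof -
    define \<Delta>D where "\<Delta>D = (\<lambda>x. \<Sum>i\<in>Basis. partial_deriv i (partial_deriv i (D j)) x)"
    have \<Delta>D: "L2_on (box a b) \<Delta>D"
      unfolding \<Delta>D_def
      by (intro L2_on_sum L2_smooth smooth_periodic_partial_deriv smooth)
    have "(\<lambda>k. L2_inner (box a b) (classical_grad (D k)) (classical_grad (D j)))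
        \<longlonglongrightarrow> L2_inner (box a b) H (classical_grad (D j))"
      by (intro L2_inner_tendsto H L2_smooth smooth)
    moreover have "(\<lambda>k. L2_inner (box a b) (classical_grad (D k)) (classical_grad (D j))) \<longlonglongrightarrow> 0"
    proof -
      have "(\<lambda>k. L2_inner (box a b) (D k) \<Delta>D) \<longlonglongrightarrow> L2_inner (box a b) (\<lambda>_. 0) \<Delta>D"
        using D by (intro L2_inner_tendsto L2_on_zero L2_smooth smooth \<Delta>D) simp
      then have "(\<lambda>k. - L2_inner (box a b) (D k) \<Delta>D) \<longlonglongrightarrow> - 0"
        by (intro tendsto_minus) (simp add: L2_inner_def)
      then show ?thesis by (simp add: Green_identity smooth \<Delta>D_def)
    qed
    ultimately show ?thesis by (metis LIMSEQ_unique L2_inner_commute)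
  qed
  have "(\<lambda>j. L2_inner (box a b) (classical_grad (D j)) H) \<longlonglongrightarrow> L2_inner (box a b) H H"
    by (intro L2_inner_tendsto H L2_smooth smooth)
  then have "L2_inner (box a b) H H = 0" by (simp add: ortho LIMSEQ_const_iff)
  then show ?thesis by (rule L2_inner_self_eq_0_AE[OF H(1)])
qed

lemma weak_grad_unique:
  assumes "has_grad_per a b u G" "has_grad_per a b u G'"
  shows "AE x in lebesgue_on (box a b). G x = G' x"
proof -
  have "has_grad_per a b (\<lambda>_. 0) (\<lambda>x. G x - G' x)"
    using has_grad_per_lincomb[OF assms, of 1 "-1"] by simp
  then obtain \<psi> where "\<And>k. smooth_periodic a b (\<psi> k)"
    "(\<lambda>k. L2_norm (box a b) (\<psi> k)) \<longlonglongrightarrow> 0" "L2_on (box a b) (\<lambda>x. G x - G' x)"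
    "(\<lambda>k. L2_norm (box a b) (\<lambda>x. classical_grad (\<psi> k) x - (G x - G' x))) \<longlonglongrightarrow> 0"
    unfolding has_grad_per_def by auto
  then have "AE x in lebesgue_on (box a b). G x - G' x = 0"
    by (rule gradient_closable)
  then show ?thesis by simp
qed

end

section \<open>Embedding into the fourth-power integrable functions\<close>

text \<open>
  The minimum of \<open>g\<^sup>2\<close> is at most its mean, and from the minimizer the function \<open>g\<^sup>2\<close> grows by at
  most the integral of \<open>\<bar>2 g g'\<bar> \<le> g\<^sup>2 + g'\<^sup>2\<close>.
\<close>

lemma square_le_integral:
  fixes g :: "real \<Rightarrow> real"
  assumes cd: "c < d" and x: "x \<in> {c..d}"
    and der: "\<And>s. s \<in> {c..d} \<Longrightarrow> (g has_real_derivative g' s) (at s within {c..d})"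
    and cont: "continuous_on {c..d} g'"
  shows "(g x)\<^sup>2 \<le> integral {c..d} (\<lambda>s. (1 / (d - c) + 1) * (g s)\<^sup>2 + (g' s)\<^sup>2)"
proof -
  have cg: "continuous_on {c..d} g"
    using der by (meson DERIV_continuous continuous_on_eq_continuous_within)
  note intros = integrable_continuous_real continuous_intros cg cont
  obtain m where m: "m \<in> {c..d}" "\<And>s. s \<in> {c..d} \<Longrightarrow> (g m)\<^sup>2 \<le> (g s)\<^sup>2"
  proof -
    have "\<exists>m\<in>{c..d}. \<forall>s\<in>{c..d}. (g m)\<^sup>2 \<le> (g s)\<^sup>2"
      using cd by (intro continuous_attains_inf continuous_intros cg) auto
    then show ?thesis using that by blast
  qed
  have "(d - c) * (g m)\<^sup>2 = integral {c..d} (\<lambda>s. (g m)\<^sup>2)" using cd by simp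
  also have "\<dots> \<le> integral {c..d} (\<lambda>s. (g s)\<^sup>2)" by (intro integral_le intros m)
  finally have min_le: "(g m)\<^sup>2 \<le> integral {c..d} (\<lambda>s. 1 / (d - c) * (g s)\<^sup>2)"
    using cd by (simp add: field_simps)
  have increment: "(g q)\<^sup>2 - (g p)\<^sup>2 \<le> integral {c..d} (\<lambda>s. (g s)\<^sup>2 + (g' s)\<^sup>2) \<and>
      (g p)\<^sup>2 - (g q)\<^sup>2 \<le> integral {c..d} (\<lambda>s. (g s)\<^sup>2 + (g' s)\<^sup>2)"
    if pq: "c \<le> p" "p \<le> q" "q \<le> d" for p q
  proof -
    have I: "((\<lambda>s. 2 * g s * g' s) has_integral (g q)\<^sup>2 - (g p)\<^sup>2) {p..q}"
    proof (rule fundamental_theorem_of_calculus)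
      fix s assume s: "s \<in> {p..q}"
      have "(g has_real_derivative g' s) (at s within {p..q})"
        using s pq by (intro DERIV_subset[OF der]) auto
      then show "((\<lambda>s. (g s)\<^sup>2) has_vector_derivative 2 * g s * g' s) (at s within {p..q})"
        unfolding has_real_derivative_iff_has_vector_derivative[symmetric]
        by (auto intro!: derivative_eq_intros)
    qed (use pq in auto)
    have "\<bar>2 * g s * g' s\<bar> \<le> (g s)\<^sup>2 + (g' s)\<^sup>2" for s
      using sum_squares_bound[of "g s" "g' s"] sum_squares_bound[of "g s" "- g' s"] by auto
    then have "norm (integral {p..q} (\<lambda>s. 2 * g s * g' s)) \<le> integral {p..q} (\<lambda>s. (g s)\<^sup>2 + (g' s)\<^sup>2)"
      using pq I
      by (intro integral_norm_bound_integral)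
        (auto intro!: intros continuous_on_subset[OF cg] continuous_on_subset[OF cont])
    also have "\<dots> \<le> integral {c..d} (\<lambda>s. (g s)\<^sup>2 + (g' s)\<^sup>2)"
      using pq
      by (intro integral_subset_le)
        (auto intro!: intros continuous_on_subset[OF cg] continuous_on_subset[OF cont])
    finally show ?thesis using integral_unique[OF I] by auto
  qed
  have "(g x)\<^sup>2 - (g m)\<^sup>2 \<le> integral {c..d} (\<lambda>s. (g s)\<^sup>2 + (g' s)\<^sup>2)"
    using increment[of m x] increment[of x m] x m(1) by (cases "m \<le> x") auto
  with min_le have "(g x)\<^sup>2 \<le> integral {c..d} (\<lambda>s. 1 / (d - c) * (g s)\<^sup>2)
      + integral {c..d} (\<lambda>s. (g s)\<^sup>2 + (g' s)\<^sup>2)" by simp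
  also have "\<dots> = integral {c..d} (\<lambda>s. 1 / (d - c) * (g s)\<^sup>2 + ((g s)\<^sup>2 + (g' s)\<^sup>2))"
    by (intro integral_add[symmetric] intros)
  finally show ?thesis by (simp add: algebra_simps)
qed

context rectangle
begin

text \<open>
  The constant dominates the constants of \<open>square_le_integral\<close> in both coordinate directions.
\<close>

definition slice_const :: real where
  "slice_const = 1 / (fst b - fst a) + 1 / (snd b - snd a) + 1"

text \<open>
  On horizontal and on vertical lines \<open>u\<^sup>2\<close> is bounded by the integral of
  \<open>p = slice_const u\<^sup>2 + \<bar>\<nabla>u\<bar>\<^sup>2\<close> over that line. One factor \<open>u\<^sup>2\<close> is estimated by a function
  \<open>A\<close> of \<open>y\<close> and the other by a function \<open>B\<close> of \<open>x\<close>, so that the integral of the product factorizes.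
\<close>

lemma Ladyzhenskaya_smooth:
  assumes u: "smooth_periodic a b u"
  shows "integral (cbox a b) (\<lambda>x. (u x)^4)
    \<le> (slice_const * (L2_norm (box a b) u)\<^sup>2 + (L2_norm (box a b) (classical_grad u))\<^sup>2)\<^sup>2"
proof -
  note cont_u = smooth_periodic_continuous[OF u]
  note cont_D = smooth_periodic_continuous[OF smooth_periodic_partial_deriv[OF u]]
  define p where "p = (\<lambda>x. slice_const * (u x)\<^sup>2 + (norm (classical_grad u x))\<^sup>2)"
  have grad2: "(norm (classical_grad u x))\<^sup>2
      = (partial_deriv (1, 0) u x)\<^sup>2 + (partial_deriv (0, 1) u x)\<^sup>2" for x
    unfolding power2_norm_eq_inner classical_grad_inner
    by (simp add: Basis_real_prod power2_eq_square)
  have cont_p: "continuous_on X p" for X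
    unfolding p_def by (intro continuous_intros cont_u smooth_periodic_continuous_classical_grad[OF u])
  have cont_px: "continuous_on X (\<lambda>x. p (x, y))" for X y
    by (rule continuous_on_compose2[OF cont_p[of UNIV]]) (auto intro!: continuous_intros)
  have cont_py: "continuous_on X (\<lambda>y. p (x, y))" for X x
    by (rule continuous_on_compose2[OF cont_p[of UNIV]]) (auto intro!: continuous_intros)
  have p_ge: "(1 / (fst b - fst a) + 1) * (u z)\<^sup>2 + (partial_deriv (1, 0) u z)\<^sup>2 \<le> p z"
    "(1 / (snd b - snd a) + 1) * (u z)\<^sup>2 + (partial_deriv (0, 1) u z)\<^sup>2 \<le> p z" for z
  proof -
    have "(1 / (fst b - fst a) + 1) * (u z)\<^sup>2 \<le> slice_const * (u z)\<^sup>2"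
      "(1 / (snd b - snd a) + 1) * (u z)\<^sup>2 \<le> slice_const * (u z)\<^sup>2"
      using fst_less snd_less by (intro mult_right_mono; simp add: slice_const_def)+
    then show "(1 / (fst b - fst a) + 1) * (u z)\<^sup>2 + (partial_deriv (1, 0) u z)\<^sup>2 \<le> p z"
      "(1 / (snd b - snd a) + 1) * (u z)\<^sup>2 + (partial_deriv (0, 1) u z)\<^sup>2 \<le> p z"
      unfolding p_def grad2
      using zero_le_power2[of "partial_deriv (1, 0) u z"] zero_le_power2[of "partial_deriv (0, 1) u z"]
      by linarith+
  qed
  define A where "A = (\<lambda>y. integral {fst a..fst b} (\<lambda>x. p (x, y)))"
  define B where "B = (\<lambda>x. integral {snd a..snd b} (\<lambda>y. p (x, y)))"
  have cont_A: "continuous_on {snd a..snd b} A"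
    unfolding A_def interval_cbox
    by (rule integral_continuous_on_param)
      (auto simp: split_def intro!: continuous_on_compose2[OF cont_p[of UNIV]] continuous_intros)
  have cont_B: "continuous_on {fst a..fst b} B"
    unfolding B_def interval_cbox
    by (rule integral_continuous_on_param)
      (auto simp: split_def intro!: continuous_on_compose2[OF cont_p[of UNIV]] continuous_intros)
  have pointwise: "(u (x, y))^4 \<le> A y * B x"
    if x: "x \<in> {fst a..fst b}" and y: "y \<in> {snd a..snd b}" for x y
  proof -
    have diff: "u differentiable at z" for z by (rule smooth_periodic_differentiable[OF u])
    have "(u (x, y))\<^sup>2 \<le> integral {fst a..fst b} (\<lambda>s. (1 / (fst b - fst a) + 1) * (u (s, y))\<^sup>2
        + (partial_deriv (1, 0) u (s, y))\<^sup>2)"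
      using fst_less x has_real_derivative_slice(1)[OF diff]
      by (intro square_le_integral[where g = "\<lambda>s. u (s, y)"])
        (auto intro!: continuous_on_compose2[OF cont_D[of "(1, 0)" UNIV]] continuous_intros
          simp: Basis_real_prod)
    also have "\<dots> \<le> A y"
      unfolding A_def using fst_less snd_less
      by (intro integral_le integrable_continuous_real cont_px continuous_intros
          continuous_on_compose2[OF cont_u[of UNIV]] continuous_on_compose2[OF cont_D[of "(1, 0)" UNIV]])
        (auto simp: Basis_real_prod intro: p_ge)
    finally have A: "(u (x, y))\<^sup>2 \<le> A y" .
    have "(u (x, y))\<^sup>2 \<le> integral {snd a..snd b} (\<lambda>s. (1 / (snd b - snd a) + 1) * (u (x, s))\<^sup>2
        + (partial_deriv (0, 1) u (x, s))\<^sup>2)"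
      using snd_less y has_real_derivative_slice(2)[OF diff]
      by (intro square_le_integral[where g = "\<lambda>s. u (x, s)"])
        (auto intro!: continuous_on_compose2[OF cont_D[of "(0, 1)" UNIV]] continuous_intros
          simp: Basis_real_prod)
    also have "\<dots> \<le> B x"
      unfolding B_def using fst_less snd_less
      by (intro integral_le integrable_continuous_real cont_py continuous_intros
          continuous_on_compose2[OF cont_u[of UNIV]] continuous_on_compose2[OF cont_D[of "(0, 1)" UNIV]])
        (auto simp: Basis_real_prod intro: p_ge)
    finally have B: "(u (x, y))\<^sup>2 \<le> B x" .
    have "(u (x, y))^4 = (u (x, y))\<^sup>2 * (u (x, y))\<^sup>2" by (simp add: power4_eq_xxxx power2_eq_square)
    also have "\<dots> \<le> A y * B x"
      using A B by (intro mult_mono) (auto intro: order_trans[OF zero_le_power2])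
    finally show ?thesis .
  qed
  have "integral (cbox a b) (\<lambda>x. (u x)^4) \<le> integral (cbox a b) (\<lambda>x. A (snd x) * B (fst x))"
  proof (rule integral_le)
    show "(\<lambda>x. (u x)^4) integrable_on cbox a b"
      by (intro integrable_continuous continuous_intros cont_u)
    show "(\<lambda>x. A (snd x) * B (fst x)) integrable_on cbox a b"
      by (intro integrable_continuous continuous_intros continuous_on_compose2[OF cont_A]
          continuous_on_compose2[OF cont_B]) (auto simp: mem_box Basis_real_prod inner_prod_def)
    show "(u x)^4 \<le> A (snd x) * B (fst x)" if "x \<in> cbox a b" for x
      using pointwise[of "fst x" "snd x"] that by (auto simp: mem_box Basis_real_prod inner_prod_def)
  qed
  also have "\<dots> = integral {fst a..fst b} (\<lambda>x. integral {snd a..snd b} (\<lambda>y. A y * B x))"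
    by (subst integral_iterated(1))
      (auto intro!: continuous_intros continuous_on_compose2[OF cont_A]
          continuous_on_compose2[OF cont_B] simp: mem_box Basis_real_prod inner_prod_def)
  also have "\<dots> = integral {snd a..snd b} A * integral {fst a..fst b} B"
    by simp
  also have "\<dots> = (integral (cbox a b) p)\<^sup>2"
    using integral_iterated[OF cont_p[of "cbox a b"]] by (simp add: A_def B_def power2_eq_square)
  also have "integral (cbox a b) p
      = slice_const * (L2_norm (box a b) u)\<^sup>2 + (L2_norm (box a b) (classical_grad u))\<^sup>2"
    unfolding L2_norm_power2 p_def
    by (simp add: L2_inner_continuous cont_u smooth_periodic_continuous_classical_grad[OF u]
        integral_add integrable_continuous continuous_intros power2_norm_eq_inner flip: power2_eq_square)
  finally show ?thesis .
qed

text \<open>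
  A subsequence of the smooth approximations converges almost everywhere, and Fatou's lemma carries
  their uniform bound over to the limit.
\<close>

lemma H1_per_L4:
  assumes "u \<in> H1_per a b"
  shows "integrable (lebesgue_on (box a b)) (\<lambda>x. (u x)^4)"
proof -
  let ?M = "lebesgue_on (box a b)"
  obtain G \<psi> where u: "L2_on (box a b) u" "L2_on (box a b) G"
    and \<psi>: "\<And>k. smooth_periodic a b (\<psi> k)"
      "(\<lambda>k. L2_norm (box a b) (\<lambda>x. \<psi> k x - u x)) \<longlonglongrightarrow> 0"
      "(\<lambda>k. L2_norm (box a b) (\<lambda>x. classical_grad (\<psi> k) x - G x)) \<longlonglongrightarrow> 0"
    using assms unfolding H1_per_def has_grad_per_def by blast
  note L2_smooth = L2_on_continuous[OF smooth_periodic_continuous[OF \<psi>(1)]]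
    L2_on_continuous[OF smooth_periodic_continuous_classical_grad[OF \<psi>(1)]]
  define bound where "bound = (\<lambda>k. (slice_const * (L2_norm (box a b) (\<psi> k))\<^sup>2
      + (L2_norm (box a b) (classical_grad (\<psi> k)))\<^sup>2)\<^sup>2)"
  have "convergent bound"
  proof -
    have "bound \<longlonglongrightarrow> (slice_const * (L2_norm (box a b) u)\<^sup>2 + (L2_norm (box a b) G)\<^sup>2)\<^sup>2"
      unfolding bound_def by (intro tendsto_intros L2_norm_tendsto u \<psi> L2_smooth)
    then show ?thesis by (rule convergentI)
  qed
  then obtain K where K: "\<And>k. norm (bound k) \<le> K"
    using convergent_imp_Bseq Bseq_def by metis
  have sq: "norm ((\<psi> k x - u x)\<^sup>2) = (\<psi> k x - u x) \<bullet> (\<psi> k x - u x)" for k x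
    by (simp add: power2_eq_square)
  have "\<exists>r. strict_mono r \<and> (AE x in ?M. (\<lambda>k. (\<psi> (r k) x - u x)\<^sup>2) \<longlonglongrightarrow> 0)"
  proof (rule tendsto_L1_AE_subseq)
    show "integrable ?M (\<lambda>x. (\<psi> k x - u x)\<^sup>2)" for k
      using L2_integrable_inner[OF L2_on_diff L2_on_diff, OF L2_smooth(1) u(1) L2_smooth(1) u(1)]
      by (simp add: power2_eq_square)
    have "(\<lambda>k. (L2_norm (box a b) (\<lambda>x. \<psi> k x - u x))\<^sup>2) \<longlonglongrightarrow> 0\<^sup>2"
      by (intro tendsto_intros \<psi>)
    then show "(\<lambda>k. \<integral>x. norm ((\<psi> k x - u x)\<^sup>2) \<partial>?M) \<longlonglongrightarrow> 0"
      unfolding L2_norm_power2 sq L2_inner_def by simp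
  qed
  then obtain r where r: "AE x in ?M. (\<lambda>k. (\<psi> (r k) x - u x)\<^sup>2) \<longlonglongrightarrow> 0" by blast
  have meas: "u \<in> borel_measurable ?M" "\<psi> k \<in> borel_measurable ?M" for k
    using u L2_smooth by (auto simp: L2_on_def)
  have "(\<integral>\<^sup>+x. ennreal ((u x)^4) \<partial>?M) = (\<integral>\<^sup>+x. liminf (\<lambda>k. ennreal ((\<psi> (r k) x)^4)) \<partial>?M)"
  proof (rule nn_integral_cong_AE)
    show "AE x in ?M. ennreal ((u x)^4) = liminf (\<lambda>k. ennreal ((\<psi> (r k) x)^4))"
      using r
    proof eventually_elim
      case (elim x)
      have "(\<lambda>k. sqrt ((\<psi> (r k) x - u x)\<^sup>2)) \<longlonglongrightarrow> sqrt 0" by (intro tendsto_intros elim)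
      then have "(\<lambda>k. \<psi> (r k) x) \<longlonglongrightarrow> u x" by (simp add: LIM_zero_iff tendsto_rabs_zero_iff)
      then have "(\<lambda>k. ennreal ((\<psi> (r k) x)^4)) \<longlonglongrightarrow> ennreal ((u x)^4)"
        by (intro tendsto_intros tendsto_ennrealI)
      then show ?case using lim_imp_Liminf[OF sequentially_bot] by metis
    qed
  qed
  also have "\<dots> \<le> liminf (\<lambda>k. \<integral>\<^sup>+x. ennreal ((\<psi> (r k) x)^4) \<partial>?M)"
    using meas by (intro nn_integral_liminf) auto
  also have "\<dots> \<le> liminf (\<lambda>k. ennreal K)"
  proof (rule Liminf_mono, rule always_eventually, rule allI)
    fix k
    have c: "continuous_on (cbox a b) (\<lambda>x. (\<psi> (r k) x)\<^sup>2)"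
      by (intro continuous_intros smooth_periodic_continuous[OF \<psi>(1)])
    have four: "(\<psi> (r k) x)\<^sup>2 \<bullet> (\<psi> (r k) x)\<^sup>2 = (\<psi> (r k) x)^4" for x
      by (simp add: power4_eq_xxxx power2_eq_square)
    have "(\<integral>\<^sup>+x. ennreal ((\<psi> (r k) x)^4) \<partial>?M) = ennreal (\<integral>x. (\<psi> (r k) x)^4 \<partial>?M)"
      using L2_integrable_inner[OF L2_on_continuous[OF c] L2_on_continuous[OF c]]
      unfolding four by (intro nn_integral_eq_integral) auto
    also have "(\<integral>x. (\<psi> (r k) x)^4 \<partial>?M) = integral (cbox a b) (\<lambda>x. (\<psi> (r k) x)^4)"
      using L2_inner_continuous[OF c c] unfolding L2_inner_def four .
    also have "\<dots> \<le> bound (r k)"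
      unfolding bound_def by (rule Ladyzhenskaya_smooth[OF \<psi>(1)])
    also have "\<dots> \<le> K" using K[of "r k"] by simp
    finally show "(\<integral>\<^sup>+x. ennreal ((\<psi> (r k) x)^4) \<partial>?M) \<le> ennreal K"
      by (simp add: ennreal_leI)
  qed
  also have "\<dots> < \<infinity>" by (simp add: Liminf_const)
  finally show ?thesis
    using meas(1) by (intro integrableI_bounded) auto
qed

end

section \<open>Potentials and energy dissipation\<close>

context rectangle
begin

lemma has_grad_per_sum:
  assumes "\<And>i. i \<in> I \<Longrightarrow> has_grad_per a b (u i) (G i)"
  shows "has_grad_per a b (\<lambda>x. \<Sum>i\<in>I. c i * u i x) (\<lambda>x. \<Sum>i\<in>I. c i *\<^sub>R G i x)"
  using assms
proof (induction I rule: infinite_finite_induct)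
  case (insert i I)
  have "has_grad_per a b (\<lambda>x. c i * u i x + 1 * (\<Sum>i\<in>I. c i * u i x))
      (\<lambda>x. c i *\<^sub>R G i x + 1 *\<^sub>R (\<Sum>i\<in>I. c i *\<^sub>R G i x))"
    by (intro has_grad_per_lincomb insert) auto
  then show ?case using insert by simp
qed (simp_all add: has_grad_per_const)

lemma H1_per_lincomb:
  "u \<in> H1_per a b \<Longrightarrow> v \<in> H1_per a b \<Longrightarrow> (\<lambda>x. c * u x + d * v x) \<in> H1_per a b"
  unfolding H1_per_def using has_grad_per_lincomb by blast

lemma H1_per_diff: "u \<in> H1_per a b \<Longrightarrow> v \<in> H1_per a b \<Longrightarrow> (\<lambda>x. u x - v x) \<in> H1_per a b"
  using H1_per_lincomb[of u v 1 "-1"] by simp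

lemma has_grad_per_grad: "u \<in> H1_per a b \<Longrightarrow> has_grad_per a b u (grad a b u)"
  unfolding H1_per_def grad_def by (metis (mono_tags) mem_Collect_eq someI_ex)

lemma H1_per_L2: "u \<in> H1_per a b \<Longrightarrow> L2_on (box a b) u"
  "u \<in> H1_per a b \<Longrightarrow> L2_on (box a b) (grad a b u)"
  using has_grad_per_grad by (auto simp: has_grad_per_def)

lemma L2_inner_grad_cong:
  assumes "has_grad_per a b u G" "has_grad_per a b v H"
  shows "L2_inner (box a b) (grad a b u) (grad a b v) = L2_inner (box a b) G H"
proof -
  have uv: "has_grad_per a b u (grad a b u)" "has_grad_per a b v (grad a b v)"
    using assms by (auto intro!: has_grad_per_grad simp: H1_per_def)
  show ?thesis
    using weak_grad_unique[OF uv(1) assms(1)] weak_grad_unique[OF uv(2) assms(2)] uv assms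
    by (intro L2_inner_cong_AE) (auto simp: has_grad_per_def)
qed

text \<open>
  The relation \<open>w = (-\<Delta>)\<^sup>-\<^sup>1 v\<close> without the normalization of the mean, so that it is linear and
  can be read off from the scheme.
\<close>

definition is_potential :: "(real \<times> real \<Rightarrow> real) \<Rightarrow> (real \<times> real \<Rightarrow> real) \<Rightarrow> bool" where
  "is_potential w v \<longleftrightarrow> w \<in> H1_per a b \<and>
     (\<forall>\<eta>\<in>H1_per a b. L2_inner (box a b) (grad a b w) (grad a b \<eta>) = L2_inner (box a b) v \<eta>)"

lemma is_potential_lincomb:
  assumes "is_potential w v" "is_potential w' v'" and L2: "L2_on (box a b) v" "L2_on (box a b) v'"
  shows "is_potential (\<lambda>x. c * w x + d * w' x) (\<lambda>x. c * v x + d * v' x)"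
  unfolding is_potential_def
proof (intro conjI ballI)
  have w: "w \<in> H1_per a b" "w' \<in> H1_per a b" using assms by (auto simp: is_potential_def)
  then show "(\<lambda>x. c * w x + d * w' x) \<in> H1_per a b" by (rule H1_per_lincomb)
  fix \<eta> assume \<eta>: "\<eta> \<in> H1_per a b"
  have "L2_inner (box a b) (grad a b (\<lambda>x. c * w x + d * w' x)) (grad a b \<eta>)
      = L2_inner (box a b) (\<lambda>x. c *\<^sub>R grad a b w x + d *\<^sub>R grad a b w' x) (grad a b \<eta>)"
    by (intro L2_inner_grad_cong has_grad_per_lincomb has_grad_per_grad w \<eta>)
  also have "\<dots> = c * L2_inner (box a b) (grad a b w) (grad a b \<eta>)
      + d * L2_inner (box a b) (grad a b w') (grad a b \<eta>)"
    using w \<eta> by (simp add: L2_inner_add_left L2_inner_scaleR_left L2_on_scaleR H1_per_L2)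
  also have "\<dots> = c * L2_inner (box a b) v \<eta> + d * L2_inner (box a b) v' \<eta>"
    using assms \<eta> by (simp add: is_potential_def)
  also have "\<dots> = L2_inner (box a b) (\<lambda>x. c *\<^sub>R v x + d *\<^sub>R v' x) \<eta>"
    using L2 \<eta> L2_on_scaleR[OF L2(1), of c] L2_on_scaleR[OF L2(2), of d]
    by (subst L2_inner_add_left) (simp_all only: L2_inner_scaleR_left H1_per_L2)
  finally show "L2_inner (box a b) (grad a b (\<lambda>x. c * w x + d * w' x)) (grad a b \<eta>)
      = L2_inner (box a b) (\<lambda>x. c * v x + d * v' x) \<eta>" by simp
qed

lemma is_potential_const: "is_potential (\<lambda>_. c) (\<lambda>_. 0)"
proof -
  have "L2_inner (box a b) (grad a b (\<lambda>_. c)) (grad a b \<eta>) = 0" if "\<eta> \<in> H1_per a b" for \<eta>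
    using L2_inner_grad_cong[OF has_grad_per_const[of a b c] has_grad_per_grad[OF that]]
    by (simp add: L2_inner_def)
  then show ?thesis
    using has_grad_per_const[of a b c] by (auto simp: is_potential_def H1_per_def L2_inner_def)
qed

lemma is_potential_sum:
  assumes "\<And>i. i \<in> I \<Longrightarrow> is_potential (w i) (v i)" "\<And>i. i \<in> I \<Longrightarrow> L2_on (box a b) (v i)"
  shows "is_potential (\<lambda>x. \<Sum>i\<in>I. c i * w i x) (\<lambda>x. \<Sum>i\<in>I. c i * v i x)"
  using assms
proof (induction I rule: infinite_finite_induct)
  case (insert i I)
  have "L2_on (box a b) (\<lambda>x. \<Sum>i\<in>I. c i *\<^sub>R v i x)"
    using insert by (intro L2_on_sum L2_on_scaleR) auto
  then have "is_potential (\<lambda>x. c i * w i x + 1 * (\<Sum>i\<in>I. c i * w i x))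
      (\<lambda>x. c i * v i x + 1 * (\<Sum>i\<in>I. c i * v i x))"
    using insert by (intro is_potential_lincomb) auto
  then show ?case using insert by simp
qed (simp_all add: is_potential_const)

lemma L2_inner_one_pos: "L2_inner (box a b) (\<lambda>_. 1::real) (\<lambda>_. 1) > 0"
proof -
  have "L2_inner (box a b) (\<lambda>_. 1::real) (\<lambda>_. 1) = measure lborel (cbox a b)"
    by (simp add: L2_inner_continuous)
  moreover have "measure lborel (cbox a b) > 0"
    using fst_less snd_less by (simp add: content_pos_lt_eq Basis_real_prod inner_prod_def)
  ultimately show ?thesis by simp
qed

text \<open>
  Subtracting the mean from \<open>w\<close> shows that the choice in \<open>inv_neg_laplacian\<close> has a witness. Testing
  the equations of the chosen function and of \<open>w\<close> with each other shows that both have the same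
  Dirichlet energy.
\<close>

lemma Hm1_norm_potential:
  assumes w: "is_potential w v" and v: "L2_on (box a b) v"
  shows "(Hm1_norm a b v)\<^sup>2 = L2_inner (box a b) (grad a b w) (grad a b w)"
proof -
  let ?Q = "\<lambda>w. w \<in> H1_per a b \<and> L2_inner (box a b) w (\<lambda>_. 1) = 0 \<and>
        (\<forall>\<eta>\<in>H1_per a b. L2_inner (box a b) (grad a b w) (grad a b \<eta>) = L2_inner (box a b) v \<eta>)"
  define m where "m = L2_inner (box a b) w (\<lambda>_. 1) / L2_inner (box a b) (\<lambda>_. 1::real) (\<lambda>_. 1)"
  have one: "L2_on (box a b) (\<lambda>_. 1::real)" by (rule L2_on_continuous) simp
  have wH: "w \<in> H1_per a b" using w by (simp add: is_potential_def)
  have "is_potential (\<lambda>x. 1 * w x + (- m) * 1) (\<lambda>x. 1 * v x + (- m) * 0)"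
    by (intro is_potential_lincomb is_potential_const w v L2_on_zero)
  then have "is_potential (\<lambda>x. w x - m *\<^sub>R 1) v" by simp
  moreover have "L2_inner (box a b) (\<lambda>x. w x - m *\<^sub>R 1) (\<lambda>_. 1) = 0"
    using L2_inner_one_pos
    by (subst L2_inner_diff_left)
      (simp_all only: L2_inner_scaleR_left H1_per_L2[OF wH] one L2_on_scaleR m_def, simp)
  ultimately have "\<exists>w. ?Q w" unfolding is_potential_def by blast
  then have Q: "?Q (inv_neg_laplacian a b v)"
    unfolding inv_neg_laplacian_def by (rule someI_ex)
  have "L2_inner (box a b) (inv_neg_laplacian a b v) v
      = L2_inner (box a b) (grad a b w) (grad a b (inv_neg_laplacian a b v))"
    using Q w by (metis L2_inner_commute is_potential_def)
  also have "\<dots> = L2_inner (box a b) (grad a b w) (grad a b w)"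
    using Q w by (metis L2_inner_commute is_potential_def)
  finally show ?thesis
    unfolding Hm1_norm_def by (simp add: L2_inner_self_nonneg)
qed

text \<open>
  The discretization of the nonlinearity is designed for this identity: it is a difference quotient of
  the double well up to a remainder with a sign, whatever the distance of \<open>u\<close> and \<open>v\<close>.
\<close>

lemma f_half_identity:
  "f_half u v * (u - v) = double_well u - double_well v + (u - v)^4 / 12"
  unfolding f_half_def double_well_def
  by (simp add: power2_eq_square power3_eq_cube power4_eq_xxxx field_simps)

text \<open>
  The gradient terms match exactly, since \<open>\<nabla>(u + v)/2 \<bullet> \<nabla>(u - v)\<close> is half the difference of the squares;
  the nonlinear terms differ by the integral of \<open>(u - v)\<^sup>4 / 12\<close>.
\<close>

lemma free_energy_diff_le:
  assumes u: "u \<in> H1_per a b" and v: "v \<in> H1_per a b"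
  shows "free_energy a b \<epsilon> u - free_energy a b \<epsilon> v
    \<le> L2_inner (box a b) (\<lambda>x. f_half (u x) (v x)) (\<lambda>x. u x - v x)
      + \<epsilon>\<^sup>2 * L2_inner (box a b) (grad a b (\<lambda>x. (u x + v x) / 2)) (grad a b (\<lambda>x. u x - v x))"
proof -
  let ?M = "lebesgue_on (box a b)"
  have F: "integrable ?M (\<lambda>x. double_well (w x))" if w: "w \<in> H1_per a b" for w
  proof -
    have "integrable ?M (\<lambda>x. 1 * 1 :: real)"
      using L2_integrable_inner[of "box a b" "\<lambda>_. 1::real" "\<lambda>_. 1"] L2_on_continuous[of a b "\<lambda>_. 1::real"]
      by simp
    moreover have "integrable ?M (\<lambda>x. (w x)\<^sup>2)"
      using L2_integrable_inner[OF H1_per_L2(1)[OF w] H1_per_L2(1)[OF w]]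
      by (simp add: power2_eq_square)
    moreover have "double_well (w x) = 1/4 * (w x)^4 - 1/2 * (w x)\<^sup>2 + 1/4" for x
      unfolding double_well_def by algebra
    ultimately show ?thesis using H1_per_L4[OF w] by simp
  qed
  have "L2_inner (box a b) (\<lambda>x. f_half (u x) (v x)) (\<lambda>x. u x - v x)
      = (\<integral>x. double_well (u x) - double_well (v x) + (u x - v x)^4 / 12 \<partial>?M)"
    by (simp add: L2_inner_def f_half_identity)
  also have "\<dots> = (\<integral>x. double_well (u x) \<partial>?M) - (\<integral>x. double_well (v x) \<partial>?M)
      + (\<integral>x. (u x - v x)^4 \<partial>?M) / 12"
    using F[OF u] F[OF v] H1_per_L4[OF H1_per_diff[OF u v]] by simp
  also have "\<dots> \<ge> (\<integral>x. double_well (u x) \<partial>?M) - (\<integral>x. double_well (v x) \<partial>?M)"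
    by simp
  finally have well: "L2_inner (box a b) (\<lambda>x. double_well (u x)) (\<lambda>_. 1)
        - L2_inner (box a b) (\<lambda>x. double_well (v x)) (\<lambda>_. 1)
      \<le> L2_inner (box a b) (\<lambda>x. f_half (u x) (v x)) (\<lambda>x. u x - v x)"
    by (simp add: L2_inner_def)
  let ?G = "grad a b u" and ?H = "grad a b v"
  have "L2_inner (box a b) (grad a b (\<lambda>x. 1/2 * u x + 1/2 * v x)) (grad a b (\<lambda>x. 1 * u x + (-1) * v x))
      = L2_inner (box a b) (\<lambda>x. (1/2) *\<^sub>R ?G x + (1/2) *\<^sub>R ?H x) (\<lambda>x. 1 *\<^sub>R ?G x + (-1) *\<^sub>R ?H x)"
    by (intro L2_inner_grad_cong has_grad_per_lincomb has_grad_per_grad u v)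
  also have "\<dots> = L2_inner (box a b) (\<lambda>x. (1/2) *\<^sub>R (?G x + ?H x)) (\<lambda>x. ?G x - ?H x)"
    by (simp add: scaleR_add_right)
  also have "\<dots> = 1/2 * (L2_inner (box a b) ?G ?G - L2_inner (box a b) ?H ?H)"
    unfolding L2_inner_scaleR_left
    using H1_per_L2(2)[OF u] H1_per_L2(2)[OF v] L2_inner_commute[of "box a b" ?H ?G]
    by (simp add: L2_inner_add_left L2_inner_diff_right L2_on_diff)
  finally have gradients: "L2_inner (box a b) (grad a b (\<lambda>x. (u x + v x) / 2)) (grad a b (\<lambda>x. u x - v x))
      = 1/2 * ((L2_norm (box a b) ?G)\<^sup>2 - (L2_norm (box a b) ?H)\<^sup>2)"
    by (simp add: L2_norm_power2 add_divide_distrib)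
  show ?thesis using well unfolding gradients free_energy_def by (simp add: algebra_simps)
qed

end

locale L1h_scheme = rectangle a b + time_mesh \<alpha> t N
  for a b :: "real \<times> real" and \<alpha> :: real and t :: "nat \<Rightarrow> real" and N :: nat +
  fixes \<kappa> \<epsilon> :: real and \<phi> \<mu> :: "nat \<Rightarrow> real \<times> real \<Rightarrow> real"
  assumes kappa_pos: "\<kappa> > 0"
    and solution: "L1h_solution a b \<alpha> \<kappa> \<epsilon> t N \<phi> \<mu>"
begin

lemma H1_solution: "n \<le> N \<Longrightarrow> \<phi> n \<in> H1_per a b" "n \<in> {1..N} \<Longrightarrow> \<mu> n \<in> H1_per a b"
  using solution by (auto simp: L1h_solution_def)

lemma H1_increment: "n \<in> {1..N} \<Longrightarrow> (\<lambda>x. \<phi> n x - \<phi> (n - 1) x) \<in> H1_per a b"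
  by (intro H1_per_diff H1_solution) auto

lemma mass_equation:
  assumes "n \<in> {1..N}" "\<eta> \<in> H1_per a b"
  shows "L2_inner (box a b) (\<lambda>x. \<Sum>k = 1..n. L1h_kernel \<alpha> t n k * (\<phi> k x - \<phi> (k - 1) x)) \<eta>
    = - \<kappa> * L2_inner (box a b) (grad a b (\<mu> n)) (grad a b \<eta>)"
  using solution assms unfolding L1h_solution_def by blast

lemma chemical_potential_equation:
  assumes "n \<in> {1..N}" "\<eta> \<in> H1_per a b"
  shows "L2_inner (box a b) (\<mu> n) \<eta>
    = L2_inner (box a b) (\<lambda>x. f_half (\<phi> n x) (\<phi> (n - 1) x)) \<eta>
      + \<epsilon>\<^sup>2 * L2_inner (box a b) (grad a b (\<lambda>x. (\<phi> n x + \<phi> (n - 1) x) / 2)) (grad a b \<eta>)"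
  using solution assms unfolding L1h_solution_def by blast

lemma L1h_kernel_eq:
  "L1h_kernel \<alpha> t n k = (if k = n then aux_kernel \<alpha> t n n / 2 else aux_kernel \<alpha> t n k)"
  by (simp add: aux_kernel_def)

text \<open>
  The first equation says that \<open>- \<kappa> \<mu> n\<close> is a potential of the discrete fractional derivative. The latter is a
  combination of \<open>v\<^sub>1, \<dots>, v\<^sub>n\<close> in which \<open>v\<^sub>n\<close> has a positive coefficient, so potentials
  of all increments are obtained by forward substitution.
\<close>

lemma increment_potential_exists:
  assumes "n \<in> {1..N}"
  shows "\<exists>V. is_potential V (\<lambda>x. \<phi> n x - \<phi> (n - 1) x)"
  using assms
proof (induction n rule: less_induct)
  case (less n)
  let ?v = "\<lambda>k x. \<phi> k x - \<phi> (k - 1) x" and ?a = "L1h_kernel \<alpha> t n"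
  let ?z = "\<lambda>x. \<Sum>k = 1..n. ?a k * ?v k x"
  have L2_v: "L2_on (box a b) (?v k)" if "k \<in> {1..n}" for k
    using that less.prems by (intro H1_per_L2 H1_increment) auto
  have L2_sum: "L2_on (box a b) (\<lambda>x. \<Sum>k\<in>K. ?a k * ?v k x)" if "K \<subseteq> {1..n}" for K
  proof -
    have "L2_on (box a b) (\<lambda>x. \<Sum>k\<in>K. ?a k *\<^sub>R ?v k x)"
      using that by (intro L2_on_sum L2_on_scaleR L2_v) auto
    then show ?thesis by simp
  qed
  obtain V where V: "\<And>k. k \<in> {1..<n} \<Longrightarrow> is_potential (V k) (?v k)"
  proof -
    have "\<forall>k\<in>{1..<n}. \<exists>V. is_potential V (?v k)" using less by auto
    then show ?thesis using that by metis
  qed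
  have old: "is_potential (\<lambda>x. \<Sum>k\<in>{1..<n}. ?a k * V k x) (\<lambda>x. \<Sum>k\<in>{1..<n}. ?a k * ?v k x)"
    using V L2_v by (intro is_potential_sum) auto
  have \<mu>: "\<mu> n \<in> H1_per a b" using less.prems by (rule H1_solution)
  \<comment> \<open>The vanishing second term casts \<open>- \<kappa> \<mu> n\<close> as a linear combination of two functions.\<close>
  have "is_potential (\<lambda>x. - \<kappa> * \<mu> n x + 0 * \<mu> n x) ?z"
    unfolding is_potential_def
  proof (intro conjI ballI)
    show "(\<lambda>x. - \<kappa> * \<mu> n x + 0 * \<mu> n x) \<in> H1_per a b" by (intro H1_per_lincomb \<mu>)
    fix \<eta> assume \<eta>: "\<eta> \<in> H1_per a b"
    have "L2_inner (box a b) (grad a b (\<lambda>x. - \<kappa> * \<mu> n x + 0 * \<mu> n x)) (grad a b \<eta>)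
        = L2_inner (box a b) (\<lambda>x. (- \<kappa>) *\<^sub>R grad a b (\<mu> n) x + 0 *\<^sub>R grad a b (\<mu> n) x) (grad a b \<eta>)"
      by (intro L2_inner_grad_cong has_grad_per_lincomb has_grad_per_grad \<mu> \<eta>)
    also have "\<dots> = - \<kappa> * L2_inner (box a b) (grad a b (\<mu> n)) (grad a b \<eta>)"
      using L2_inner_scaleR_left[of "box a b" "- \<kappa>" "grad a b (\<mu> n)"] by simp
    finally show "L2_inner (box a b) (grad a b (\<lambda>x. - \<kappa> * \<mu> n x + 0 * \<mu> n x)) (grad a b \<eta>)
        = L2_inner (box a b) ?z \<eta>"
      using mass_equation[OF less.prems \<eta>] by simp
  qed
  then have "is_potential (\<lambda>x. 1 / ?a n * (- \<kappa> * \<mu> n x + 0 * \<mu> n x)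
        + - 1 / ?a n * (\<Sum>k\<in>{1..<n}. ?a k * V k x))
      (\<lambda>x. 1 / ?a n * ?z x + - 1 / ?a n * (\<Sum>k\<in>{1..<n}. ?a k * ?v k x))"
    by (rule is_potential_lincomb[OF _ old L2_sum L2_sum]) auto
  moreover have "(\<lambda>x. 1 / ?a n * ?z x + - 1 / ?a n * (\<Sum>k\<in>{1..<n}. ?a k * ?v k x)) = ?v n"
  proof
    fix x
    have "?z x = ?a n * ?v n x + (\<Sum>k\<in>{1..<n}. ?a k * ?v k x)"
      using less.prems by (simp add: sum.last_plus)
    moreover have "?a n \<noteq> 0"
      using aux_kernel_pos[of n n] less.prems by (simp add: L1h_kernel_eq)
    ultimately show "1 / ?a n * ?z x + - 1 / ?a n * (\<Sum>k\<in>{1..<n}. ?a k * ?v k x) = ?v n x"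
      by (simp add: add_divide_distrib)
  qed
  ultimately show ?case by (simp only:) blast
qed

text \<open>
  With potentials \<open>V k\<close> of the increments, the \<open>H\<^sup>-\<^sup>1\<close> inner products become \<open>L\<^sup>2\<close> inner products of
  the gradients \<open>g k\<close>, and the lower bound of the convolution can be integrated pointwise.
\<close>

lemma modified_energy_dissipation:
  assumes n: "n \<in> {1..N}"
  shows "modified_energy a b \<alpha> \<kappa> \<epsilon> t \<phi> n \<le> modified_energy a b \<alpha> \<kappa> \<epsilon> t \<phi> (n - 1)"
proof -
  let ?S = "box a b"
  let ?M = "lebesgue_on ?S"
  let ?v = "\<lambda>k x. \<phi> k x - \<phi> (k - 1) x"
  obtain V where V: "\<And>k. k \<in> {1..N} \<Longrightarrow> is_potential (V k) (?v k)"
    using increment_potential_exists by metis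
  have VH: "V k \<in> H1_per a b" if "k \<in> {1..N}" for k
    using V[OF that] by (simp add: is_potential_def)
  define g where "g = (\<lambda>k. grad a b (V k))"
  define w where "w = (\<lambda>j x. \<Sum>l = 1..j. aux_kernel \<alpha> t j l *\<^sub>R g l x)"
  have L2_g: "L2_on ?S (g k)" if "k \<in> {1..N}" for k
    unfolding g_def by (rule H1_per_L2[OF VH[OF that]])
  have L2_w: "L2_on ?S (w j)" if "j \<le> N" for j
    unfolding w_def using that by (intro L2_on_sum L2_on_scaleR L2_g) auto
  have L2_v: "L2_on ?S (?v k)" if "k \<in> {1..N}" for k
    by (rule H1_per_L2[OF H1_increment[OF that]])
  have Hm1: "(Hm1_norm a b (\<lambda>x. \<Sum>l = 1..j. aux_kernel \<alpha> t j l * ?v l x))\<^sup>2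
      = L2_inner ?S (w j) (w j)" if j: "j \<le> N" for j
  proof -
    let ?W = "\<lambda>x. \<Sum>l = 1..j. aux_kernel \<alpha> t j l * V l x"
    have "L2_on ?S (\<lambda>x. \<Sum>l = 1..j. aux_kernel \<alpha> t j l *\<^sub>R ?v l x)"
      using j by (intro L2_on_sum L2_on_scaleR L2_v) auto
    then have "(Hm1_norm a b (\<lambda>x. \<Sum>l = 1..j. aux_kernel \<alpha> t j l * ?v l x))\<^sup>2
        = L2_inner ?S (grad a b ?W) (grad a b ?W)"
      using j V L2_v by (intro Hm1_norm_potential is_potential_sum) auto
    also have "\<dots> = L2_inner ?S (w j) (w j)"
      unfolding w_def g_def using j VH
      by (intro L2_inner_grad_cong has_grad_per_sum has_grad_per_grad) auto
    finally show ?thesis .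
  qed
  have dissipated: "1/2 * (\<Sum>j = 1..n. doc_kernel \<alpha> t n j * L2_inner ?S (w j) (w j))
      \<le> L2_inner ?S (w n) (g n) - 1/2 * aux_kernel \<alpha> t n n * L2_inner ?S (g n) (g n)"
  proof -
    have i1: "integrable ?M (\<lambda>x. w j x \<bullet> w j x)" if "j \<in> {1..n}" for j
      using that n by (intro L2_integrable_inner L2_w) auto
    have i2: "integrable ?M (\<lambda>x. w n x \<bullet> g n x)" "integrable ?M (\<lambda>x. g n x \<bullet> g n x)"
      using n by (auto intro!: L2_integrable_inner L2_w L2_g)
    have "(\<integral>x. 1/2 * (\<Sum>j = 1..n. doc_kernel \<alpha> t n j * (w j x \<bullet> w j x)) \<partial>?M)
        \<le> (\<integral>x. w n x \<bullet> g n x - 1/2 * aux_kernel \<alpha> t n n * (g n x \<bullet> g n x) \<partial>?M)"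
    proof (rule integral_mono)
      show "1/2 * (\<Sum>j = 1..n. doc_kernel \<alpha> t n j * (w j x \<bullet> w j x))
          \<le> w n x \<bullet> g n x - 1/2 * aux_kernel \<alpha> t n n * (g n x \<bullet> g n x)" for x
        using convolution_lower_bound[OF n, of "\<lambda>l. g l x"]
        by (simp add: w_def power2_norm_eq_inner)
      show "integrable ?M (\<lambda>x. 1/2 * (\<Sum>j = 1..n. doc_kernel \<alpha> t n j * (w j x \<bullet> w j x)))"
        by (intro integrable_mult_right Bochner_Integration.integrable_sum i1)
    qed (use i2 in auto)
    then show ?thesis
      using i1 i2 by (simp add: L2_inner_def)
  qed
  \<comment> \<open>The first equation tested with \<open>V n\<close>: moving the gradient from \<open>V n\<close> back to \<open>\<mu> n\<close>
    produces the increment \<open>v n\<close>.\<close>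
  have tested: "L2_inner ?S (w n) (g n) - 1/2 * aux_kernel \<alpha> t n n * L2_inner ?S (g n) (g n)
      = - \<kappa> * L2_inner ?S (\<mu> n) (?v n)"
  proof -
    let ?a = "L1h_kernel \<alpha> t n"
    let ?Z = "\<lambda>x. \<Sum>k = 1..n. ?a k * V k x"
    have split: "(\<Sum>k = 1..n. ?a k *\<^sub>R g k x) = w n x - (1/2 * aux_kernel \<alpha> t n n) *\<^sub>R g n x" for x
    proof -
      have eq: "sum f {1..n} = f n + sum f {1..<n}" for f :: "nat \<Rightarrow> real \<times> real"
        using n by (simp add: sum.last_plus)
      have "(\<Sum>k = 1..<n. ?a k *\<^sub>R g k x) = (\<Sum>k = 1..<n. aux_kernel \<alpha> t n k *\<^sub>R g k x)"
        by (intro sum.cong) (auto simp: L1h_kernel_eq)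
      moreover have "?a n *\<^sub>R g n x = aux_kernel \<alpha> t n n *\<^sub>R g n x - (1/2 * aux_kernel \<alpha> t n n) *\<^sub>R g n x"
        by (simp add: L1h_kernel_eq flip: scaleR_diff_left)
      ultimately show ?thesis unfolding w_def eq by simp
    qed
    have "L2_inner ?S (w n) (g n) - 1/2 * aux_kernel \<alpha> t n n * L2_inner ?S (g n) (g n)
        = L2_inner ?S (\<lambda>x. w n x - (1/2 * aux_kernel \<alpha> t n n) *\<^sub>R g n x) (g n)"
      using n by (subst L2_inner_diff_left) (auto intro!: L2_w L2_g L2_on_scaleR simp: L2_inner_scaleR_left)
    also have "\<dots> = L2_inner ?S (grad a b ?Z) (grad a b (V n))"
    proof (rule L2_inner_grad_cong[symmetric])
      have "has_grad_per a b ?Z (\<lambda>x. \<Sum>k = 1..n. ?a k *\<^sub>R g k x)"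
        unfolding g_def using n VH by (intro has_grad_per_sum has_grad_per_grad) auto
      then show "has_grad_per a b ?Z (\<lambda>x. w n x - (1/2 * aux_kernel \<alpha> t n n) *\<^sub>R g n x)"
        by (simp only: split)
      show "has_grad_per a b (V n) (g n)"
        unfolding g_def by (rule has_grad_per_grad[OF VH[OF n]])
    qed
    also have "\<dots> = L2_inner ?S (\<lambda>x. \<Sum>k = 1..n. ?a k * ?v k x) (V n)"
    proof -
      have "is_potential ?Z (\<lambda>x. \<Sum>k = 1..n. ?a k * ?v k x)"
        using n V L2_v by (intro is_potential_sum) auto
      then show ?thesis using VH[OF n] by (simp add: is_potential_def)
    qed
    also have "\<dots> = - \<kappa> * L2_inner ?S (grad a b (\<mu> n)) (grad a b (V n))"
      by (rule mass_equation[OF n VH[OF n]])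
    also have "L2_inner ?S (grad a b (\<mu> n)) (grad a b (V n)) = L2_inner ?S (\<mu> n) (?v n)"
      using V[OF n] H1_solution(2)[OF n] by (metis L2_inner_commute is_potential_def)
    finally show ?thesis .
  qed
  have "free_energy a b \<epsilon> (\<phi> n) - free_energy a b \<epsilon> (\<phi> (n - 1)) \<le> L2_inner ?S (\<mu> n) (?v n)"
    unfolding chemical_potential_equation[OF n H1_increment[OF n]]
    using n by (intro free_energy_diff_le H1_solution) auto
  also have "\<dots> \<le> - (1 / (2 * \<kappa>)) * (\<Sum>j = 1..n. doc_kernel \<alpha> t n j * L2_inner ?S (w j) (w j))"
    using dissipated unfolding tested using kappa_pos by (simp add: field_simps)
  finally have free: "free_energy a b \<epsilon> (\<phi> n) - free_energy a b \<epsilon> (\<phi> (n - 1))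
      \<le> - (1 / (2 * \<kappa>)) * (\<Sum>j = 1..n. doc_kernel \<alpha> t n j * L2_inner ?S (w j) (w j))" .
  have energy: "modified_energy a b \<alpha> \<kappa> \<epsilon> t \<phi> m = free_energy a b \<epsilon> (\<phi> m)
      + 1 / (2 * \<kappa>) * (\<Sum>j = 1..m. dcc_kernel \<alpha> t m j * L2_inner ?S (w j) (w j))" if "m \<le> N" for m
  proof -
    have "(\<Sum>j = 1..m. dcc_kernel \<alpha> t m j *
          (Hm1_norm a b (\<lambda>x. \<Sum>l = 1..j. aux_kernel \<alpha> t j l * ?v l x))\<^sup>2)
        = (\<Sum>j = 1..m. dcc_kernel \<alpha> t m j * L2_inner ?S (w j) (w j))"
      using that by (intro sum.cong refl) (subst Hm1, auto)
    then show ?thesis unfolding modified_energy_def by simp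
  qed
  have "(\<Sum>j = 1..n. dcc_kernel \<alpha> t n j * L2_inner ?S (w j) (w j))
      = (\<Sum>j = 1..n - 1. dcc_kernel \<alpha> t (n - 1) j * L2_inner ?S (w j) (w j))
        + (\<Sum>j = 1..n. doc_kernel \<alpha> t n j * L2_inner ?S (w j) (w j))"
    using dcc_kernel_diff[of n "\<lambda>j. L2_inner ?S (w j) (w j)"] n by simp
  moreover have "n \<le> N" "n - 1 \<le> N" using n by auto
  ultimately show ?thesis using free by (simp add: energy distrib_left)
qed

end

theorem theorem3p4:
  fixes a b :: "real \<times> real"
    and \<alpha> \<kappa> \<epsilon> T :: real
    and N :: nat
    and t :: "nat \<Rightarrow> real"
    and \<phi> \<mu> :: "nat \<Rightarrow> real \<times> real \<Rightarrow> real"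
  assumes "fst a < fst b" and "snd a < snd b"
    and "0 < \<alpha>" and "\<alpha> < 1" and "\<kappa> > 0" and "\<epsilon> > 0"
    and "t 0 = 0" and "\<forall>n\<in>{1..N}. t (n - 1) < t n" and "t N = T"
    and "L1h_solution a b \<alpha> \<kappa> \<epsilon> t N \<phi> \<mu>"
  shows "\<forall>n\<in>{1..N}.
    (modified_energy a b \<alpha> \<kappa> \<epsilon> t \<phi> n - modified_energy a b \<alpha> \<kappa> \<epsilon> t \<phi> (n - 1))
      / (t n - t (n - 1)) \<le> 0"
proof
  fix n assume n: "n \<in> {1..N}"
  interpret L1h_scheme a b \<alpha> t N \<kappa> \<epsilon> \<phi> \<mu>
    using assms by unfold_locales auto
  show "(modified_energy a b \<alpha> \<kappa> \<epsilon> t \<phi> n - modified_energy a b \<alpha> \<kappa> \<epsilon> t \<phi> (n - 1))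
      / (t n - t (n - 1)) \<le> 0"
    using modified_energy_dissipation[OF n] step_pos[OF n] by (intro divide_nonpos_pos) auto
qed

end
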